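(* Let $\Xi_M$ be the set of inconsistency pairs defined in the context. (1) For all sets $A,B,C$: $A\perp^{\Xi_M}_CB$ if and only if $\operatorname{acl}(AD)\cap B\subseteq\operatorname{acl}D$ for every set $D$ such that $C\subseteq D\subseteq BC$. (2) $\Xi_M$ is transitive and normal. (3) $A\perp^{M}_CB$ implies $A\perp^{\Xi_M}_CB$. (4) $\perp^{\text{þ}}=\perp^{M*}=\perp^{\Xi_M*}$.
   Context: $T$ is a complete consistent first-order theory (possibly many-sorted); we work in a big saturated model of $T$. All sets are small subsets of the big model; $BC$ means $B\cup C$; $\operatorname{acl}$ is algebraic closure. A tuple also denotes the set of its entries, and $\bar a\in A$ means that all entries of $\bar a$ lie in $A$. $A\equiv_BA'$ means that some automorphism fixing $B$ pointwise maps the set $A$ onto $A'$. For a ternary relation $\perp$, the relation $\perp^*$ is defined by: $A\perp^*_CB$ iff for all $\hat B\supseteq B$ there is $A'\equiv_{BC}A$ such that $A'\perp_C\hat B$. M-dividing independence: $A\perp^M_CB$ iff $\operatorname{acl}(AC')\cap\operatorname{acl}(BC')=\operatorname{acl}C'$ for every $C'$ with $C\subseteq C'\subseteq\operatorname{acl}(BC)$. Thorn-forking independence $\perp^{\text{þ}}$ is defined as $\perp^{M*}$. Inconsistency pairs: for a formula $\varphi(\bar x;\bar y)$ whose free variables are partitioned into two blocks, a parameter-free formula $\psi(\bar y_0,\dots,\bar y_{k-1})$ (also written $\psi(\bar y_{<k})$) is a $k$-inconsistency witness for $\varphi(\bar x;\bar y)$ if $\big(\bigwedge_{i<k}\varphi(\bar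 x;\bar y_i)\big)\wedge\psi(\bar y_{<k})$ is inconsistent. $\Xi$ is the set of all pairs $(\varphi,\psi)$ such that, for some $k<\omega$, $\psi$ is a $k$-inconsistency witness for $\varphi$. $\Xi_M$ is the set of all pairs $(\varphi(\bar x;u\bar v),\psi((u\bar v)_{<k}))\in\Xi$ such that $u$ is a single variable, $\bar v$ is a tuple of variables, and $\psi((u\bar v)_{<k})$ is the formula $\bigwedge_{i<j<k}(u_i\neq u_j\wedge\bar v_i=\bar v_j)$. (The position of the distinguished variable $u$ within the right-hand block is immaterial, and formulas $\psi$ of this form are identified when they differ only by trivial rewriting of the conjunction.) For $(\varphi,\psi)\in\Xi$, a formula $\varphi(\bar x;\bar b)$ $(\varphi,\psi)$-divides over $C$ if there is a sequence $(\bar b_i)_{i<\omega}$ such that each $\bar b_i$ realises $\operatorname{tp}(\bar b/C)$ and $\models\psi(\bar b_{i_0},\dots,\bar b_{i_{k-1}})$ for all $i_0<\dots<i_{k-1}<\omega$. For $\Omega\subseteq\Xi$, a partial type $\Omega$-divides over $C$ if for some $(\varphi,\psi)\in\Omega$ it contains a formula $\varphi(\bar x;\bar b)$ that $(\varphi,\psi)$-divides over $C$. Define $A\perp^{\Omega}_CB$ iff there is no $\bar a\in A$ such that $\operatorname{tp}(\bar a/BC)$ $\Omega$-divides over $C$. - $\Omega$ is transitive if: whenever $(\varphi(\bar y;\bar x),\psi(\bar x_{<k}))\in\Omega$, $D\subseteq C$, $C\perp^\Omega_D\bar a$ and $\varphi(\bar y;\bar a)$ $(\varphi,\psi)$-divides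 over $D$, then $\varphi(\bar y;\bar a)$ $(\varphi,\psi)$-divides over $C$. - $\Omega$ is normal if: whenever $(\varphi(\bar x,\bar z;\bar y),\psi(\bar y_{<k}))\in\Omega$, then also $(\varphi(\bar x;\bar z,\bar y),\psi'(\bar y_{<k},\bar z_{<k}))\in\Omega$, where $\psi'$ is $\psi(\bar y_{<k})\wedge(\bar z_0=\bar z_1=\dots=\bar z_{k-1})$. *)

theory Defs
  imports Main
begin

unbundle cardinal_syntax

section \<open>Many-sorted first-order logic\<close>

text \<open>The type \<open>'s\<close> is the set of sorts. The symbols of a signature are those
  on which the partial maps \<^term>\<open>fsig\<close>, \<^term>\<open>rsig\<close> are defined, so that either kind of
  symbol may be absent. Every sort has countably many variables.\<close>

record ('f, 'r, 's) signature =
  fsig :: "'f \<Rightarrow> ('s list \<times> 's) option"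
  rsig :: "'r \<Rightarrow> 's list option"

type_synonym 's var = "'s \<times> nat"

datatype ('f, 's) tm = Var "'s var" | Fn 'f "('f, 's) tm list"

datatype ('f, 'r, 's) fm =
    Top
  | Eq "('f, 's) tm" "('f, 's) tm"
  | Rel 'r "('f, 's) tm list"
  | Neg "('f, 'r, 's) fm"
  | And "('f, 'r, 's) fm" "('f, 'r, 's) fm"
  | Ex "'s var" "('f, 'r, 's) fm"

inductive has_sort :: "('f, 'r, 's) signature \<Rightarrow> ('f, 's) tm \<Rightarrow> 's \<Rightarrow> bool" for L where
  "has_sort L (Var x) (fst x)"
| "\<lbrakk>fsig L f = Some (ss, s); list_all2 (has_sort L) ts ss\<rbrakk> \<Longrightarrow> has_sort L (Fn f ts) s"

primrec wf_fm :: "('f, 'r, 's) signature \<Rightarrow> ('f, 'r, 's) fm \<Rightarrow> bool" where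
  "wf_fm L Top \<longleftrightarrow> True"
| "wf_fm L (Eq t u) \<longleftrightarrow> (\<exists>s. has_sort L t s \<and> has_sort L u s)"
| "wf_fm L (Rel r ts) \<longleftrightarrow> (\<exists>ss. rsig L r = Some ss \<and> list_all2 (has_sort L) ts ss)"
| "wf_fm L (Neg \<phi>) \<longleftrightarrow> wf_fm L \<phi>"
| "wf_fm L (And \<phi> \<psi>) \<longleftrightarrow> wf_fm L \<phi> \<and> wf_fm L \<psi>"
| "wf_fm L (Ex x \<phi>) \<longleftrightarrow> wf_fm L \<phi>"

primrec fv_tm :: "('f, 's) tm \<Rightarrow> 's var set" where
  "fv_tm (Var x) = {x}"
| "fv_tm (Fn f ts) = \<Union> (set (map fv_tm ts))"

primrec fv :: "('f, 'r, 's) fm \<Rightarrow> 's var set" where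
  "fv Top = {}"
| "fv (Eq t u) = fv_tm t \<union> fv_tm u"
| "fv (Rel r ts) = \<Union> (fv_tm ` set ts)"
| "fv (Neg \<phi>) = fv \<phi>"
| "fv (And \<phi> \<psi>) = fv \<phi> \<union> fv \<psi>"
| "fv (Ex x \<phi>) = fv \<phi> - {x}"

definition sentences :: "('f, 'r, 's) signature \<Rightarrow> ('f, 'r, 's) fm set" where
  "sentences L = {\<sigma>. wf_fm L \<sigma> \<and> fv \<sigma> = {}}"

text \<open>The universe of a structure is the whole type \<open>'m\<close>, each element of which has one sort
  (so the domains of distinct sorts are disjoint). Values of the interpretations outside the
  signature, or at arguments of the wrong sorts, are irrelevant.\<close>

record ('f, 'r, 's, 'm) strct =
  sig :: "('f, 'r, 's) signature"
  srt :: "'m \<Rightarrow> 's"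
  fint :: "'f \<Rightarrow> 'm list \<Rightarrow> 'm"
  rint :: "'r \<Rightarrow> 'm list \<Rightarrow> bool"

abbreviation srts :: "('f, 'r, 's, 'm) strct \<Rightarrow> 'm list \<Rightarrow> 's list" where
  "srts M \<equiv> map (srt M)"

definition is_structure :: "('f, 'r, 's, 'm) strct \<Rightarrow> bool" where
  "is_structure M \<longleftrightarrow> (\<forall>s. \<exists>a. srt M a = s) \<and>
     (\<forall>f ss s as. fsig (sig M) f = Some (ss, s) \<and> srts M as = ss \<longrightarrow> srt M (fint M f as) = s)"

primrec ev :: "('f, 'r, 's, 'm) strct \<Rightarrow> ('s var \<Rightarrow> 'm) \<Rightarrow> ('f, 's) tm \<Rightarrow> 'm" where
  "ev M e (Var x) = e x"
| "ev M e (Fn f ts) = fint M f (map (ev M e) ts)"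

primrec sat :: "('f, 'r, 's, 'm) strct \<Rightarrow> ('s var \<Rightarrow> 'm) \<Rightarrow> ('f, 'r, 's) fm \<Rightarrow> bool" where
  "sat M e Top \<longleftrightarrow> True"
| "sat M e (Eq t u) \<longleftrightarrow> ev M e t = ev M e u"
| "sat M e (Rel r ts) \<longleftrightarrow> rint M r (map (ev M e) ts)"
| "sat M e (Neg \<phi>) \<longleftrightarrow> \<not> sat M e \<phi>"
| "sat M e (And \<phi> \<psi>) \<longleftrightarrow> sat M e \<phi> \<and> sat M e \<psi>"
| "sat M e (Ex x \<phi>) \<longleftrightarrow> (\<exists>a. srt M a = fst x \<and> sat M (e(x := a)) \<phi>)"

text \<open>\<open>holds M \<phi> xs as\<close>: the structure satisfies \<open>\<phi>\<close> when the variables \<open>xs\<close> take the values \<open>as\<close>.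
  It is only used when \<open>xs\<close> is distinct, contains all free variables of \<open>\<phi>\<close> and has the sorts
  of \<open>as\<close>; the value given to other variables plays no role.\<close>

definition holds ::
  "('f, 'r, 's, 'm) strct \<Rightarrow> ('f, 'r, 's) fm \<Rightarrow> 's var list \<Rightarrow> 'm list \<Rightarrow> bool" where
  "holds M \<phi> xs as \<longleftrightarrow>
     sat M (\<lambda>x. case map_of (zip xs as) x of Some a \<Rightarrow> a | None \<Rightarrow> undefined) \<phi>"

text \<open>Theories are deductively closed sets of sentences. Consistency of \<open>T\<close> is not repeated
  here, since \<open>T\<close> will be given together with a model.\<close>

definition complete_theory :: "('f, 'r, 's) signature \<Rightarrow> ('f, 'r, 's) fm set \<Rightarrow> bool" where
  "complete_theory L T \<longleftrightarrow>
     T \<subseteq> sentences L \<and> (\<forall>\<sigma> \<in> sentences L. \<sigma> \<in> T \<or> Neg \<sigma> \<in> T)"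

definition is_model :: "('f, 'r, 's, 'm) strct \<Rightarrow> ('f, 'r, 's) fm set \<Rightarrow> bool" where
  "is_model M T \<longleftrightarrow> is_structure M \<and> (\<forall>\<sigma> \<in> T. holds M \<sigma> [] [])"

section \<open>Partitioned formulas, types, algebraic closure\<close>

text \<open>\<open>(\<phi>, xs, ys)\<close> is the partitioned formula $\varphi(\bar x;\bar y)$; as usual, dummy variables
  are allowed in the blocks.\<close>

type_synonym ('f, 'r, 's) pfm = "('f, 'r, 's) fm \<times> 's var list \<times> 's var list"

fun wf_pfm :: "('f, 'r, 's) signature \<Rightarrow> ('f, 'r, 's) pfm \<Rightarrow> bool" where
  "wf_pfm L (\<phi>, xs, ys) \<longleftrightarrow>
     wf_fm L \<phi> \<and> distinct (xs @ ys) \<and> fv \<phi> \<subseteq> set xs \<union> set ys"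

fun lsorts :: "('f, 'r, 's) pfm \<Rightarrow> 's list" where
  "lsorts (\<phi>, xs, ys) = map fst xs"

fun rsorts :: "('f, 'r, 's) pfm \<Rightarrow> 's list" where
  "rsorts (\<phi>, xs, ys) = map fst ys"

fun pholds :: "('f, 'r, 's, 'm) strct \<Rightarrow> ('f, 'r, 's) pfm \<Rightarrow> 'm list \<Rightarrow> 'm list \<Rightarrow> bool" where
  "pholds M (\<phi>, xs, ys) a b \<longleftrightarrow> holds M \<phi> (xs @ ys) (a @ b)"

text \<open>A formula $\varphi(\bar x;\bar b)$ with parameters is a pair \<open>(p, b)\<close> of a partitioned formula and
  a tuple for its right block. \<open>fms_over M ss B\<close> has all those with parameters in \<open>B\<close> and
  $\bar x$ of sorts \<open>ss\<close>. The names of the variables $\bar x$ are not fixed, so a type contains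
  all renamings of its members.\<close>

definition fms_over ::
  "('f, 'r, 's, 'm) strct \<Rightarrow> 's list \<Rightarrow> 'm set \<Rightarrow> (('f, 'r, 's) pfm \<times> 'm list) set" where
  "fms_over M ss B =
     {(p, b). wf_pfm (sig M) p \<and> lsorts p = ss \<and> rsorts p = srts M b \<and> set b \<subseteq> B}"

definition tp ::
  "('f, 'r, 's, 'm) strct \<Rightarrow> 'm list \<Rightarrow> 'm set \<Rightarrow> (('f, 'r, 's) pfm \<times> 'm list) set" where
  "tp M a B = {(p, b) \<in> fms_over M (srts M a) B. pholds M p a b}"

definition realises ::
  "('f, 'r, 's, 'm) strct \<Rightarrow> 'm list \<Rightarrow> (('f, 'r, 's) pfm \<times> 'm list) set \<Rightarrow> bool" where
  "realises M a \<pi> \<longleftrightarrow> (\<forall>(p, b) \<in> \<pi>. lsorts p = srts M a \<and> pholds M p a b)"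

definition acl :: "('f, 'r, 's, 'm) strct \<Rightarrow> 'm set \<Rightarrow> 'm set" where
  "acl M B = {a. \<exists>(p, b) \<in> fms_over M [srt M a] B.
     pholds M p [a] b \<and> finite {c. srt M c = srt M a \<and> pholds M p [c] b}}"

section \<open>The big model\<close>

definition automorphism :: "('f, 'r, 's, 'm) strct \<Rightarrow> ('m \<Rightarrow> 'm) \<Rightarrow> bool" where
  "automorphism M g \<longleftrightarrow> bij g \<and> (\<forall>a. srt M (g a) = srt M a) \<and>
     (\<forall>f as s. fsig (sig M) f = Some (srts M as, s) \<longrightarrow> g (fint M f as) = fint M f (map g as)) \<and>
     (\<forall>r as. rsig (sig M) r = Some (srts M as) \<longrightarrow> (rint M r (map g as) \<longleftrightarrow> rint M r as))"

definition elementary_on :: "('f, 'r, 's, 'm) strct \<Rightarrow> 'm set \<Rightarrow> ('m \<Rightarrow> 'm) \<Rightarrow> bool" where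
  "elementary_on M A g \<longleftrightarrow> (\<forall>a \<in> A. srt M (g a) = srt M a) \<and>
     (\<forall>\<phi> xs as. wf_fm (sig M) \<phi> \<and> distinct xs \<and> fv \<phi> \<subseteq> set xs \<and> map fst xs = srts M as \<and>
        set as \<subseteq> A \<longrightarrow> (holds M \<phi> xs (map g as) \<longleftrightarrow> holds M \<phi> xs as))"

definition small :: "'k rel \<Rightarrow> 'm set \<Rightarrow> bool" where
  "small \<kappa> A \<longleftrightarrow> |A| <o \<kappa>"

definition saturated :: "('f, 'r, 's, 'm) strct \<Rightarrow> 'k rel \<Rightarrow> bool" where
  "saturated M \<kappa> \<longleftrightarrow> (\<forall>A s \<pi>. small \<kappa> A \<and> \<pi> \<subseteq> fms_over M [s] A \<and>
     (\<forall>\<pi>0 \<subseteq> \<pi>. finite \<pi>0 \<longrightarrow> (\<exists>a. srt M a = s \<and> realises M [a] \<pi>0)) \<longrightarrow>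
     (\<exists>a. srt M a = s \<and> realises M [a] \<pi>))"

definition strongly_homogeneous :: "('f, 'r, 's, 'm) strct \<Rightarrow> 'k rel \<Rightarrow> bool" where
  "strongly_homogeneous M \<kappa> \<longleftrightarrow> (\<forall>A g. small \<kappa> A \<and> elementary_on M A g \<longrightarrow>
     (\<exists>h. automorphism M h \<and> (\<forall>a \<in> A. h a = g a)))"

text \<open>Every saturated model of cardinality \<open>\<kappa>\<close> greater than the number of formulas is big with
  respect to \<open>\<kappa>\<close>; the definition also covers finite models, with any such \<open>\<kappa>\<close>. As there are
  infinitely many formulas, \<open>\<kappa>\<close> is uncountable.\<close>

definition big_model ::
  "('f, 'r, 's, 'm) strct \<Rightarrow> ('f, 'r, 's) fm set \<Rightarrow> 'k rel \<Rightarrow> bool" where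
  "big_model M T \<kappa> \<longleftrightarrow> is_model M T \<and> Card_order \<kappa> \<and> |{\<phi>. wf_fm (sig M) \<phi>}| <o \<kappa> \<and>
     saturated M \<kappa> \<and> strongly_homogeneous M \<kappa>"

definition conjugate :: "('f, 'r, 's, 'm) strct \<Rightarrow> 'm set \<Rightarrow> 'm set \<Rightarrow> 'm set \<Rightarrow> bool" where
  "conjugate M B A A' \<longleftrightarrow> (\<exists>g. automorphism M g \<and> (\<forall>b \<in> B. g b = b) \<and> g ` A = A')"

section \<open>Independence relations\<close>

text \<open>For a ternary relation \<open>R\<close>, the proposition \<open>R A C B\<close> reads: \<open>A\<close> is independent from
  \<open>B\<close> over \<open>C\<close>.\<close>

type_synonym 'm indep_rel = "'m set \<Rightarrow> 'm set \<Rightarrow> 'm set \<Rightarrow> bool"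

definition star :: "('f, 'r, 's, 'm) strct \<Rightarrow> 'k rel \<Rightarrow> 'm indep_rel \<Rightarrow> 'm indep_rel" where
  "star M \<kappa> R A C B \<longleftrightarrow> (\<forall>B'. small \<kappa> B' \<and> B \<subseteq> B' \<longrightarrow>
     (\<exists>A'. conjugate M (B \<union> C) A' A \<and> R A' C B'))"

definition M_indep :: "('f, 'r, 's, 'm) strct \<Rightarrow> 'm indep_rel" where
  "M_indep M A C B \<longleftrightarrow> (\<forall>C'. C \<subseteq> C' \<and> C' \<subseteq> acl M (B \<union> C) \<longrightarrow>
     acl M (A \<union> C') \<inter> acl M (B \<union> C') = acl M C')"

definition thorn_indep :: "('f, 'r, 's, 'm) strct \<Rightarrow> 'k rel \<Rightarrow> 'm indep_rel" where
  "thorn_indep M \<kappa> = star M \<kappa> (M_indep M)"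

section \<open>Inconsistency pairs\<close>

text \<open>\<open>(\<psi>, yss)\<close> is the formula $\psi(\bar y_0,\dots,\bar y_{k-1})$, where \<open>yss\<close> lists the
  tuples $\bar y_i$ and \<open>k = length yss\<close>.\<close>

type_synonym ('f, 'r, 's) wit = "('f, 'r, 's) fm \<times> 's var list list"

type_synonym ('f, 'r, 's) ipair = "('f, 'r, 's) pfm \<times> ('f, 'r, 's) wit"

fun wholds :: "('f, 'r, 's, 'm) strct \<Rightarrow> ('f, 'r, 's) wit \<Rightarrow> 'm list list \<Rightarrow> bool" where
  "wholds M (\<psi>, yss) bs \<longleftrightarrow> holds M \<psi> (concat yss) (concat bs)"

text \<open>Inconsistent means inconsistent with the complete theory of \<open>M\<close>, that is, not satisfied
  in \<open>M\<close>.\<close>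

fun inconsistency_witness ::
  "('f, 'r, 's, 'm) strct \<Rightarrow> nat \<Rightarrow> ('f, 'r, 's) pfm \<Rightarrow> ('f, 'r, 's) wit \<Rightarrow> bool" where
  "inconsistency_witness M k p (\<psi>, yss) \<longleftrightarrow>
     length yss = k \<and> (\<forall>ys \<in> set yss. map fst ys = rsorts p) \<and> distinct (concat yss) \<and>
     wf_fm (sig M) \<psi> \<and> fv \<psi> \<subseteq> set (concat yss) \<and>
     \<not> (\<exists>a bs. srts M a = lsorts p \<and> length bs = k \<and> (\<forall>b \<in> set bs. srts M b = rsorts p) \<and>
          (\<forall>i < k. pholds M p a (bs ! i)) \<and> wholds M (\<psi>, yss) bs)"

definition Xi :: "('f, 'r, 's, 'm) strct \<Rightarrow> ('f, 'r, 's) ipair set" where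
  "Xi M = {(p, w). wf_pfm (sig M) p \<and> (\<exists>k. inconsistency_witness M k p w)}"

definition divides ::
  "('f, 'r, 's, 'm) strct \<Rightarrow> ('f, 'r, 's) ipair \<Rightarrow> 'm list \<Rightarrow> 'm set \<Rightarrow> bool" where
  "divides M = (\<lambda>(p, w) b C. srts M b = rsorts p \<and>
     (\<exists>bs. (\<forall>i::nat. realises M (bs i) (tp M b C)) \<and>
           (\<forall>js. length js = length (snd w) \<and> sorted_wrt (<) js \<longrightarrow> wholds M w (map bs js))))"

definition type_divides ::
  "('f, 'r, 's, 'm) strct \<Rightarrow> ('f, 'r, 's) ipair set \<Rightarrow>
   (('f, 'r, 's) pfm \<times> 'm list) set \<Rightarrow> 'm set \<Rightarrow> bool" where
  "type_divides M \<Omega> \<pi> C \<longleftrightarrow> (\<exists>(p, w) \<in> \<Omega>. \<exists>b. (p, b) \<in> \<pi> \<and> divides M (p, w) b C)"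

definition Omega_indep ::
  "('f, 'r, 's, 'm) strct \<Rightarrow> ('f, 'r, 's) ipair set \<Rightarrow> 'm indep_rel" where
  "Omega_indep M \<Omega> A C B \<longleftrightarrow> \<not> (\<exists>a. set a \<subseteq> A \<and> type_divides M \<Omega> (tp M a (B \<union> C)) C)"

definition conj_list :: "('f, 'r, 's) fm list \<Rightarrow> ('f, 'r, 's) fm" where
  "conj_list \<phi>s = foldr And \<phi>s Top"

definition tuple_eq :: "'s var list \<Rightarrow> 's var list \<Rightarrow> ('f, 'r, 's) fm" where
  "tuple_eq xs ys = conj_list (map2 (\<lambda>x y. Eq (Var x) (Var y)) xs ys)"

definition index_pairs :: "nat \<Rightarrow> (nat \<times> nat) list" where
  "index_pairs k = [(i, j). j \<leftarrow> [0..<k], i \<leftarrow> [0..<j]]"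

text \<open>The chain $\bar z_0=\bar z_1=\dots=\bar z_{k-1}$, read as the conjunction of
  all $\bar z_i=\bar z_j$ with $i<j<k$.\<close>

definition tuples_equal :: "'s var list list \<Rightarrow> ('f, 'r, 's) fm" where
  "tuples_equal zss = conj_list (map (\<lambda>(i, j). tuple_eq (zss ! i) (zss ! j)) (index_pairs (length zss)))"

definition omit_nth :: "nat \<Rightarrow> 'a list \<Rightarrow> 'a list" where
  "omit_nth n xs = take n xs @ drop (Suc n) xs"

text \<open>Here \<open>n\<close> is the position of the distinguished variable \<open>u\<close> in the right-hand block.\<close>

definition psi_M :: "nat \<Rightarrow> 's var list list \<Rightarrow> ('f, 'r, 's) fm" where
  "psi_M n yss = conj_list (map (\<lambda>(i, j).
     And (Neg (Eq (Var (yss ! i ! n)) (Var (yss ! j ! n))))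
         (tuple_eq (omit_nth n (yss ! i)) (omit_nth n (yss ! j)))) (index_pairs (length yss)))"

text \<open>Two conjunctions are identified if they have the same set of conjuncts, that is, up to
  associativity, commutativity and idempotence of the conjunction, with unit \<^term>\<open>Top\<close>.\<close>

fun conjuncts :: "('f, 'r, 's) fm \<Rightarrow> ('f, 'r, 's) fm set" where
  "conjuncts Top = {}"
| "conjuncts (And \<phi> \<psi>) = conjuncts \<phi> \<union> conjuncts \<psi>"
| "conjuncts \<phi> = {\<phi>}"

definition Xi_M :: "('f, 'r, 's, 'm) strct \<Rightarrow> ('f, 'r, 's) ipair set" where
  "Xi_M M = {((\<phi>, xs, ys), (\<psi>, yss)) \<in> Xi M.
     \<exists>n < length ys. conjuncts \<psi> = conjuncts (psi_M n yss)}"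

definition transitive_pairs ::
  "('f, 'r, 's, 'm) strct \<Rightarrow> 'k rel \<Rightarrow> ('f, 'r, 's) ipair set \<Rightarrow> bool" where
  "transitive_pairs M \<kappa> \<Omega> \<longleftrightarrow> (\<forall>(p, w) \<in> \<Omega>. \<forall>D C a.
     small \<kappa> C \<and> D \<subseteq> C \<and> Omega_indep M \<Omega> C D (set a) \<and> divides M (p, w) a D \<longrightarrow>
     divides M (p, w) a C)"

text \<open>The new variables $\bar z_0,\dots,\bar z_{k-1}$ may be any fresh ones.\<close>

definition normal_pairs :: "('f, 'r, 's) ipair set \<Rightarrow> bool" where
  "normal_pairs \<Omega> \<longleftrightarrow> (\<forall>\<phi> xs zs ys \<psi> yss zss.
     ((\<phi>, xs @ zs, ys), (\<psi>, yss)) \<in> \<Omega> \<and> length zss = length yss \<and>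
     (\<forall>zs' \<in> set zss. map fst zs' = map fst zs) \<and> distinct (concat zss @ concat yss) \<longrightarrow>
     ((\<phi>, xs, zs @ ys), (And \<psi> (tuples_equal zss), map2 (@) zss yss)) \<in> \<Omega>)"

end

(*
  A pair in Xi_M expresses algebraicity: if phi(a; u, v) holds, then phi(a; -, v) has fewer than k
  solutions, so u lies in acl(a v); conversely, adding a bound on the number of solutions to a
  formula that witnesses u in acl(a v) gives such a pair. The formula phi(x; u, v) divides over C
  exactly when tp(u / C v) has infinitely many realisations, that is, when u is not in acl(C v).
  This gives (1), and (2), (3) follow formally, except for normality, which is syntactic. For (4),
  replace the larger set on the right by its algebraic closure over C, which is still small; there
  the condition of (1) is M-dividing independence.

  Algebraic closure is handled through orbits: over a small set B, an element is algebraic iff its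
  orbit under the automorphisms fixing B is finite (saturation and homogeneity).
*)

theory Submission
  imports Defs
begin

section \<open>Environments and definability\<close>

text \<open>Formulas have named variables while types fix no names, so every passage between
  formulas, tuples and types would need renaming without capture. Predicates on well-sorted
  assignments are therefore handled up to definability, and a formula is picked only where a type,
  an \<open>acl\<close> witness or a pair asks for one. The bound on the number of solutions has to
  sit inside the formula because a pair must be inconsistent for all parameters, not just for those
  at hand. With k at most 1 the formula psi is an empty conjunction. Then phi divides at every tuple
  of the right sorts, whatever is algebraic, but inconsistency leaves phi without solutions, so no
  type contains an instance of it. In (1) the set D stays inside BC, whereas M-dividing uses sets
  inside acl(BC). The star operation allows the right-hand side to be enlarged until this gap
  closes; for that, \<open>acl\<close> of a small set must be small, which is a count of formulas,
  and \<open>acl\<close> must be idempotent, which is a count of orbits.\<close>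

lemma ev_cong: "(\<And>x. x \<in> fv_tm t \<Longrightarrow> e x = e' x) \<Longrightarrow> ev M e t = ev M e' t"
proof (induction t)
  case (Fn f ts)
  then have "map (ev M e) ts = map (ev M e') ts" by auto
  then show ?case by (simp only: ev.simps)
qed simp

lemma sat_cong: "\<forall>x \<in> fv \<phi>. e x = e' x \<Longrightarrow> sat M e \<phi> \<longleftrightarrow> sat M e' \<phi>"
proof (induction \<phi> arbitrary: e e')
  case (Eq t u)
  have "ev M e t = ev M e' t" by (rule ev_cong) (use Eq in simp)
  moreover have "ev M e u = ev M e' u" by (rule ev_cong) (use Eq in simp)
  ultimately show ?case by (simp only: sat.simps)
next
  case (Rel r ts)
  have "map (ev M e) ts = map (ev M e') ts"
    using Rel.prems by (intro map_cong refl ev_cong) auto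
  then show ?case by (simp only: sat.simps)
next
  case (Neg \<phi>)
  then have "sat M e \<phi> \<longleftrightarrow> sat M e' \<phi>" by (intro Neg.IH) simp
  then show ?case by (simp only: sat.simps)
next
  case (And \<phi> \<psi>)
  have "sat M e \<phi> \<longleftrightarrow> sat M e' \<phi>" by (rule And.IH(1)) (use And.prems in simp)
  moreover have "sat M e \<psi> \<longleftrightarrow> sat M e' \<psi>" by (rule And.IH(2)) (use And.prems in simp)
  ultimately show ?case by (simp only: sat.simps)
next
  case (Ex x \<phi>)
  have "sat M (e(x := a)) \<phi> \<longleftrightarrow> sat M (e'(x := a)) \<phi>" for a
    by (rule Ex.IH) (use Ex.prems in simp)
  then show ?case by (simp only: sat.simps)
qed simp

lemma finite_fv_tm [simp]: "finite (fv_tm t)"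
  by (induction t) auto

lemma finite_fv [simp]: "finite (fv \<phi>)"
  by (induction \<phi>) auto

text \<open>The passage from tuples to assignments: once a tuple is presented as
  \<open>map e xs\<close>, changing an entry is an update of \<open>e\<close>.\<close>

lemma holds_env: "fv \<phi> \<subseteq> set xs \<Longrightarrow> holds M \<phi> xs (map e xs) \<longleftrightarrow> sat M e \<phi>"
  unfolding holds_def by (rule sat_cong) (auto simp: map_of_zip_map)

text \<open>Sorts are required of all variables, not only those of a formula, so that assignments
  can be updated and renamed without tracking which variables matter. Ill-sorted assignments are
  excluded because structures and automorphisms are constrained only at arguments of the declared
  sorts.\<close>

definition sorted_env :: "('f, 'r, 's, 'm) strct \<Rightarrow> ('s var \<Rightarrow> 'm) \<Rightarrow> bool" where
  "sorted_env M e \<longleftrightarrow> (\<forall>x. srt M (e x) = fst x)"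

lemma sorted_envD [simp]: "sorted_env M e \<Longrightarrow> srt M (e x) = fst x"
  unfolding sorted_env_def by blast

lemma sorted_envI: "(\<And>x. srt M (e x) = fst x) \<Longrightarrow> sorted_env M e"
  unfolding sorted_env_def by blast

lemma sorted_env_upd: "sorted_env M e \<Longrightarrow> srt M c = fst x \<Longrightarrow> sorted_env M (e(x := c))"
  by (rule sorted_envI) simp

lemma sorted_env_rename:
  "sorted_env M e \<Longrightarrow> (\<And>x. fst (r x) = fst x) \<Longrightarrow> sorted_env M (e \<circ> r)"
  by (rule sorted_envI) simp

lemma ex_sorted_env_extending:
  assumes "sorted_env M e0" "distinct xs" "srts M as = map fst xs"
  shows "\<exists>e. sorted_env M e \<and> map e xs = as \<and> (\<forall>x. x \<notin> set xs \<longrightarrow> e x = e0 x)"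
proof -
  have len: "length as = length xs" using assms(3) by (metis length_map)
  define e where "e x = (case map_of (zip xs as) x of Some a \<Rightarrow> a | None \<Rightarrow> e0 x)" for x
  have nth: "e (xs ! i) = as ! i" if "i < length xs" for i
    using that assms(2) len by (simp add: e_def map_of_zip_nth)
  have out: "e x = e0 x" if "x \<notin> set xs" for x
    using that len by (auto simp: e_def split: option.split dest!: map_of_SomeD set_zip_leftD)
  have "srt M (e x) = fst x" for x
  proof (cases "x \<in> set xs")
    case True
    then obtain i where i: "i < length xs" "x = xs ! i" by (metis in_set_conv_nth)
    then have "srts M as ! i = map fst xs ! i" using assms(3) by simp
    then show ?thesis using i nth len by simp
  qed (simp add: out assms(1))
  moreover have "map e xs = as" using nth len by (simp add: list_eq_iff_nth_eq)
  ultimately show ?thesis using out by (blast intro: sorted_envI)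
qed

lemma fresh_list:
  fixes F :: "'s var set"
  assumes "finite F"
  shows "\<exists>zs. map fst zs = ss \<and> distinct zs \<and> set zs \<inter> F = {}"
proof -
  obtain N where N: "\<And>x. x \<in> F \<Longrightarrow> snd x < N"
    using finite_nat_set_iff_bounded[of "snd ` F"] assms by auto
  have "map fst (zip ss [N..<N + length ss]) = ss" "distinct (zip ss [N..<N + length ss])"
    by (auto intro: distinct_zipI2)
  moreover have "set (zip ss [N..<N + length ss]) \<inter> F = {}"
    using N by (force dest: set_zip_rightD)
  ultimately show ?thesis by blast
qed

lemma fresh_var: "finite (F :: 's var set) \<Longrightarrow> \<exists>w. fst w = s \<and> w \<notin> F"
  using fresh_list[of F "[s]"] by (auto simp: map_eq_Cons_conv)

lemma fresh_lists:
  "\<exists>yss :: 's var list list. length yss = k \<and> (\<forall>ys \<in> set yss. map fst ys = ss) \<and> distinct (concat yss)"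
proof (induction k)
  case 0
  show ?case by simp
next
  case (Suc k)
  then obtain yss :: "'s var list list"
    where yss: "length yss = k" "\<forall>ys \<in> set yss. map fst ys = ss" "distinct (concat yss)" by blast
  obtain zs :: "'s var list" where "map fst zs = ss" "distinct zs" "set zs \<inter> set (concat yss) = {}"
    using fresh_list[of "set (concat yss)" ss] by auto
  with yss show ?case by (intro exI[of _ "zs # yss"]) auto
qed

text \<open>A formula up to equivalence, seen as a property of assignments. The bound
  \<open>X\<close> on the free variables is kept because it later supplies the variable blocks of
  partitioned formulas.\<close>

definition definable ::
  "('f, 'r, 's, 'm) strct \<Rightarrow> 's var set \<Rightarrow> (('s var \<Rightarrow> 'm) \<Rightarrow> bool) \<Rightarrow> bool" where
  "definable M X P \<longleftrightarrow> (\<exists>\<phi>. wf_fm (sig M) \<phi> \<and> fv \<phi> \<subseteq> X \<and>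
     (\<forall>e. sorted_env M e \<longrightarrow> (sat M e \<phi> \<longleftrightarrow> P e)))"

lemma definableI:
  "wf_fm (sig M) \<phi> \<Longrightarrow> fv \<phi> \<subseteq> X \<Longrightarrow> (\<And>e. sorted_env M e \<Longrightarrow> sat M e \<phi> \<longleftrightarrow> P e) \<Longrightarrow> definable M X P"
  by (auto simp: definable_def)

lemma definable_sat: "wf_fm (sig M) \<phi> \<Longrightarrow> definable M (fv \<phi>) (\<lambda>e. sat M e \<phi>)"
  by (rule definableI) auto

lemma definable_cong_env:
  assumes "definable M X P" "sorted_env M e" "sorted_env M e'" "\<And>x. x \<in> X \<Longrightarrow> e x = e' x"
  shows "P e \<longleftrightarrow> P e'"
proof -
  from assms(1) obtain \<phi> where \<phi>: "fv \<phi> \<subseteq> X" "\<And>e. sorted_env M e \<Longrightarrow> sat M e \<phi> \<longleftrightarrow> P e"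
    by (auto simp: definable_def)
  have "sat M e \<phi> \<longleftrightarrow> sat M e' \<phi>" using assms(4) \<phi>(1) by (intro sat_cong) auto
  then show ?thesis using \<phi>(2) assms(2,3) by simp
qed

section \<open>Closure properties of definable predicates\<close>

lemma definable_cong:
  "definable M X P \<Longrightarrow> (\<And>e. sorted_env M e \<Longrightarrow> P e \<longleftrightarrow> Q e) \<Longrightarrow> definable M X Q"
  by (auto simp: definable_def)

lemma definable_mono: "definable M X P \<Longrightarrow> X \<subseteq> Y \<Longrightarrow> definable M Y P"
  unfolding definable_def by blast

lemma definable_True: "definable M X (\<lambda>e. True)"
  by (rule definableI[of _ Top]) auto

lemma definable_eq: "fst x = fst y \<Longrightarrow> x \<in> X \<Longrightarrow> y \<in> X \<Longrightarrow> definable M X (\<lambda>e. e x = e y)"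
  by (rule definableI[of _ "Eq (Var x) (Var y)"]) (auto, metis has_sort.intros(1))

lemma definable_not: "definable M X P \<Longrightarrow> definable M X (\<lambda>e. \<not> P e)"
proof -
  assume "definable M X P"
  then obtain \<phi> where "wf_fm (sig M) \<phi>" "fv \<phi> \<subseteq> X" "\<And>e. sorted_env M e \<Longrightarrow> sat M e \<phi> \<longleftrightarrow> P e"
    unfolding definable_def by blast
  then show ?thesis by (intro definableI[of _ "Neg \<phi>"]) auto
qed

lemma definable_conj:
  assumes "definable M X P" "definable M X Q"
  shows "definable M X (\<lambda>e. P e \<and> Q e)"
proof -
  from assms obtain \<phi> \<psi> where "wf_fm (sig M) \<phi>" "fv \<phi> \<subseteq> X" "\<And>e. sorted_env M e \<Longrightarrow> sat M e \<phi> \<longleftrightarrow> P e"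
    "wf_fm (sig M) \<psi>" "fv \<psi> \<subseteq> X" "\<And>e. sorted_env M e \<Longrightarrow> sat M e \<psi> \<longleftrightarrow> Q e"
    by (auto simp: definable_def)
  then show ?thesis by (intro definableI[of _ "And \<phi> \<psi>"]) auto
qed

lemma definable_ball:
  "finite I \<Longrightarrow> (\<And>i. i \<in> I \<Longrightarrow> definable M X (P i)) \<Longrightarrow> definable M X (\<lambda>e. \<forall>i\<in>I. P i e)"
  by (induction I rule: finite_induct) (auto intro: definable_True definable_conj)

lemma definable_ex:
  assumes "definable M (insert x X) P"
  shows "definable M X (\<lambda>e. \<exists>a. srt M a = fst x \<and> P (e(x := a)))"
proof -
  from assms obtain \<phi> where "wf_fm (sig M) \<phi>" "fv \<phi> \<subseteq> insert x X"
    "\<And>e. sorted_env M e \<Longrightarrow> sat M e \<phi> \<longleftrightarrow> P e" unfolding definable_def by blast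
  then show ?thesis by (intro definableI[of _ "Ex x \<phi>"]) (auto simp: sorted_env_upd)
qed

text \<open>Substitution of variables is expressed by \<open>\<exists>x. x = y \<and> \<phi>\<close>, which avoids capture.\<close>

lemma definable_subst_var:
  assumes "definable M X P" "fst y = fst x"
  shows "definable M (insert y (X - {x})) (\<lambda>e. P (e(x := e y)))"
proof (cases "x = y")
  case True
  then show ?thesis using assms by (auto intro: definable_mono)
next
  case False
  have "definable M (insert x (insert y (X - {x}))) (\<lambda>e. e x = e y \<and> P e)"
    using assms by (intro definable_conj definable_eq definable_mono[OF assms(1)]) auto
  then show ?thesis
    using False assms(2) by (auto intro: definable_cong[OF definable_ex])
qed

text \<open>Variables are replaced one at a time. The targets avoid \<open>X\<close>, so no target
  is replaced later and the single substitutions add up to a simultaneous one, even where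
  \<open>r\<close> identifies variables.\<close>

lemma definable_rename_disjoint:
  assumes "definable M X P" "finite Y" "Y \<subseteq> X" "r ` Y \<inter> X = {}" "\<And>x. fst (r x) = fst x"
  shows "definable M (X - Y \<union> r ` Y) (\<lambda>e. P (\<lambda>x. if x \<in> Y then e (r x) else e x))"
  using assms(2,3,4)
proof (induction Y rule: finite_induct)
  case empty
  then show ?case using assms(1) by simp
next
  case (insert y Y)
  let ?Q = "\<lambda>e. P (\<lambda>x. if x \<in> Y then e (r x) else e x)"
  have "definable M (insert (r y) (X - Y \<union> r ` Y - {y})) (\<lambda>e. ?Q (e(y := e (r y))))"
    using insert assms(5) by (intro definable_subst_var) auto
  moreover have "insert (r y) (X - Y \<union> r ` Y - {y}) = X - insert y Y \<union> r ` insert y Y"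
    using insert by auto
  moreover have upd: "(\<lambda>x. if x \<in> Y then (e(y := e (r y))) (r x) else (e(y := e (r y))) x)
      = (\<lambda>x. if x \<in> insert y Y then e (r x) else e x)" for e
    using insert by (auto simp: fun_eq_iff)
  ultimately show ?case by (simp only: upd)
qed

text \<open>An arbitrary renaming is the composition of two disjoint ones, through variables with
  large indices.\<close>

lemma definable_rename:
  fixes M :: "('f, 'r, 's, 'm) strct"
  assumes P: "definable M X P" and "finite X" and r: "\<And>x. fst (r x) = fst x"
  shows "definable M (r ` X) (\<lambda>e. P (e \<circ> r))"
proof -
  have "finite (snd ` (X \<union> r ` X))" using assms(2) by simp
  then obtain N where N: "\<And>x. x \<in> X \<union> r ` X \<Longrightarrow> snd x < N"
    unfolding finite_nat_set_iff_bounded by blast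
  define s where "s x = (fst x, snd x + N)" for x :: "'s var"
  define t where "t x = (fst x, snd x - N)" for x :: "'s var"
  have ts: "t (s x) = x" for x by (simp add: s_def t_def)
  have disj: "s ` X \<inter> (X \<union> r ` X) = {}" 
  proof (rule ccontr)
    assume "s ` X \<inter> (X \<union> r ` X) \<noteq> {}"
    then obtain x where "x \<in> X" "s x \<in> X \<union> r ` X" by blast
    then show False using N[of "s x"] by (simp add: s_def)
  qed
  have 1: "definable M (X - X \<union> s ` X) (\<lambda>e. P (\<lambda>x. if x \<in> X then e (s x) else e x))"
    by (rule definable_rename_disjoint[OF P \<open>finite X\<close>]) (use disj in \<open>auto simp: s_def\<close>)
  \<comment> \<open>The second renaming starts from the shifted variables: \<open>t\<close> undoes
    the shift and \<open>r\<close> leads to the final targets, which the shift by \<open>N\<close>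
    has kept apart from them.\<close>
  have 2: "definable M (s ` X - s ` X \<union> (r \<circ> t) ` s ` X) (\<lambda>e. P (\<lambda>x. if x \<in> X then
      (\<lambda>z. if z \<in> s ` X then e ((r \<circ> t) z) else e z) (s x)
      else (\<lambda>z. if z \<in> s ` X then e ((r \<circ> t) z) else e z) x))"
  proof (rule definable_rename_disjoint)
    show "(r \<circ> t) ` s ` X \<inter> s ` X = {}" using disj by (auto simp: ts)
    show "fst ((r \<circ> t) x) = fst x" for x using r by (simp add: t_def)
  qed (use 1 \<open>finite X\<close> in simp_all)
  have "s ` X - s ` X \<union> (r \<circ> t) ` s ` X = r ` X" using ts by (simp add: image_comp comp_def)
  note 3 = 2[unfolded this]
  show ?thesis
  proof (rule definable_cong[OF 3])
    fix e assume e: "sorted_env M e"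
    define e' where "e' x = (if x \<in> X then
      (\<lambda>z. if z \<in> s ` X then e ((r \<circ> t) z) else e z) (s x)
      else (\<lambda>z. if z \<in> s ` X then e ((r \<circ> t) z) else e z) x)" for x
    have "e' x = (if x \<in> X then e (r x) else if x \<in> s ` X then e (r (t x)) else e x)" for x
      using ts by (simp add: e'_def)
    then have "sorted_env M e'" "\<And>x. x \<in> X \<Longrightarrow> e' x = (e \<circ> r) x"
      using e r by (auto intro!: sorted_envI simp: t_def)
    \<comment> \<open>The two assignments may differ off \<open>X\<close>, but \<open>P\<close>
      depends only on the values on \<open>X\<close>.\<close>
    then have "P e' \<longleftrightarrow> P (e \<circ> r)"
      using definable_cong_env[OF P] sorted_env_rename[OF e r] by blast
    then show "P (\<lambda>x. if x \<in> X then (\<lambda>z. if z \<in> s ` X then e ((r \<circ> t) z) else e z) (s x)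
      else (\<lambda>z. if z \<in> s ` X then e ((r \<circ> t) z) else e z) x) \<longleftrightarrow> P (e \<circ> r)"
      by (simp only: e'_def[abs_def])
  qed
qed

text \<open>The \<open>k\<close> solutions are quantified one after another. \<open>W\<close>
  collects the variables that hold the solutions already chosen, from which the remaining ones must
  differ; the induction needs it general.\<close>

lemma definable_at_least:
  assumes P: "definable M X P" and "finite X"
  shows "finite W \<Longrightarrow> definable M (X - {x} \<union> W) (\<lambda>e. \<exists>cs. length cs = k \<and> distinct cs \<and>
    set cs \<inter> e ` W = {} \<and> (\<forall>c \<in> set cs. srt M c = fst x \<and> P (e(x := c))))"
proof (induction k arbitrary: W)
  case 0
  show ?case by (simp add: definable_True)
next
  case (Suc k)
  let ?Q = "\<lambda>k W e. \<exists>cs. length cs = k \<and> distinct cs \<and>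
    set cs \<inter> e ` W = {} \<and> (\<forall>c \<in> set cs. srt M c = fst x \<and> P (e(x := c)))"
  obtain w where w: "fst w = fst x" "w \<notin> insert x (X \<union> W)"
    using fresh_var[of "insert x (X \<union> W)"] Suc.prems \<open>finite X\<close> by blast
  \<comment> \<open>Between variables of different sorts the equation is not well formed, but the
    inequality is then automatic.\<close>
  have neq: "definable M (insert w (X - {x} \<union> W)) (\<lambda>e. e w \<noteq> e v)" if "v \<in> W" for v
  proof (cases "fst v = fst w")
    case True
    then show ?thesis using that by (intro definable_not definable_eq) auto
  next
    case False
    then show ?thesis by (intro definable_cong[OF definable_True]) (auto dest!: arg_cong[of _ _ "srt M"])
  qed
  have "definable M (insert w (X - {x} \<union> W))
      (\<lambda>e. P (e(x := e w)) \<and> (\<forall>v\<in>W. e w \<noteq> e v) \<and> ?Q k (insert w W) e)"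
  proof (intro definable_conj definable_ball)
    show "definable M (insert w (X - {x} \<union> W)) (\<lambda>e. P (e(x := e w)))"
      by (rule definable_mono[OF definable_subst_var[OF P w(1)]]) auto
    show "definable M (insert w (X - {x} \<union> W)) (?Q k (insert w W))"
      by (rule definable_mono[OF Suc.IH]) (use Suc.prems in auto)
  qed (use neq Suc.prems in auto)
  then have *: "definable M (X - {x} \<union> W) (\<lambda>e. \<exists>a. srt M a = fst w \<and>
      P ((e(w := a))(x := (e(w := a)) w)) \<and> (\<forall>v\<in>W. (e(w := a)) w \<noteq> (e(w := a)) v) \<and>
      ?Q k (insert w W) (e(w := a)))"
    by (rule definable_ex)
  show ?case
  proof (rule definable_cong[OF *])
    fix e assume e: "sorted_env M e"
    define R where "R c \<longleftrightarrow> srt M c = fst x \<and> P (e(x := c))" for c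
    \<comment> \<open>The fresh \<open>w\<close> lies outside \<open>X\<close>, so storing a
      solution in it does not affect \<open>P\<close>.\<close>
    have upd: "P ((e(w := a))(x := c)) \<longleftrightarrow> P (e(x := c))" if "srt M a = fst x" "srt M c = fst x" for a c
      by (rule definable_cong_env[OF P]) (use e w that in \<open>auto intro!: sorted_env_upd\<close>)
    have Q: "?Q k (insert w W) (e(w := a)) \<longleftrightarrow> (\<exists>cs. length cs = k \<and> distinct cs \<and>
        set cs \<inter> insert a (e ` W) = {} \<and> (\<forall>c \<in> set cs. R c))" if "srt M a = fst x" for a
    proof -
      have "(e(w := a)) ` insert w W = insert a (e ` W)" using w by auto
      moreover have "(\<forall>c \<in> set cs. srt M c = fst x \<and> P ((e(w := a))(x := c))) \<longleftrightarrow> (\<forall>c \<in> set cs. R c)" for cs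
        using upd[OF that] R_def by meson
      ultimately show ?thesis by (simp only:)
    qed
    have W: "(\<forall>v\<in>W. (e(w := a)) w \<noteq> (e(w := a)) v) \<longleftrightarrow> a \<notin> e ` W" for a
      using w by auto
    have "(\<exists>a. srt M a = fst w \<and>
      P ((e(w := a))(x := (e(w := a)) w)) \<and> (\<forall>v\<in>W. (e(w := a)) w \<noteq> (e(w := a)) v) \<and>
      ?Q k (insert w W) (e(w := a))) \<longleftrightarrow> (\<exists>a. R a \<and> a \<notin> e ` W \<and>
        (\<exists>cs. length cs = k \<and> distinct cs \<and> set cs \<inter> insert a (e ` W) = {} \<and> (\<forall>c \<in> set cs. R c)))"
    proof (rule ex_cong1)
      fix a
      have "P ((e(w := a))(x := (e(w := a)) w)) \<longleftrightarrow> P (e(x := a))" if "srt M a = fst x"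
        using upd[OF that that] by simp
      then show "(srt M a = fst w \<and>
        P ((e(w := a))(x := (e(w := a)) w)) \<and> (\<forall>v\<in>W. (e(w := a)) w \<noteq> (e(w := a)) v) \<and>
        ?Q k (insert w W) (e(w := a))) \<longleftrightarrow> (R a \<and> a \<notin> e ` W \<and>
          (\<exists>cs. length cs = k \<and> distinct cs \<and> set cs \<inter> insert a (e ` W) = {} \<and> (\<forall>c \<in> set cs. R c)))"
        unfolding W w(1) using Q[of a] R_def[of a] by argo
    qed
    also have "\<dots> \<longleftrightarrow> (\<exists>ds. length ds = Suc k \<and> distinct ds \<and> set ds \<inter> e ` W = {} \<and> (\<forall>c \<in> set ds. R c))"
    proof
      assume "\<exists>a. R a \<and> a \<notin> e ` W \<and>
        (\<exists>cs. length cs = k \<and> distinct cs \<and> set cs \<inter> insert a (e ` W) = {} \<and> (\<forall>c \<in> set cs. R c))"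
      then obtain a cs where "R a" "a \<notin> e ` W" "length cs = k" "distinct cs"
        "set cs \<inter> insert a (e ` W) = {}" "\<forall>c \<in> set cs. R c" by blast
      then show "\<exists>ds. length ds = Suc k \<and> distinct ds \<and> set ds \<inter> e ` W = {} \<and> (\<forall>c \<in> set ds. R c)"
        by (intro exI[of _ "a # cs"]) auto
    next
      assume "\<exists>ds. length ds = Suc k \<and> distinct ds \<and> set ds \<inter> e ` W = {} \<and> (\<forall>c \<in> set ds. R c)"
      then obtain ds where ds: "length ds = Suc k" "distinct ds" "set ds \<inter> e ` W = {}" "\<forall>c \<in> set ds. R c"
        by blast
      then obtain a cs where "ds = a # cs" by (cases ds) auto
      with ds show "\<exists>a. R a \<and> a \<notin> e ` W \<and>
        (\<exists>cs. length cs = k \<and> distinct cs \<and> set cs \<inter> insert a (e ` W) = {} \<and> (\<forall>c \<in> set cs. R c))"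
        by (intro exI[of _ a] conjI exI[of _ cs]) auto
    qed
    finally show "(\<exists>a. srt M a = fst w \<and>
      P ((e(w := a))(x := (e(w := a)) w)) \<and> (\<forall>v\<in>W. (e(w := a)) w \<noteq> (e(w := a)) v) \<and>
      ?Q k (insert w W) (e(w := a))) \<longleftrightarrow> ?Q (Suc k) W e"
      unfolding R_def .
  qed
qed

lemma at_least_iff_card:
  "(\<exists>cs. length cs = Suc m \<and> distinct cs \<and> set cs \<subseteq> S) \<longleftrightarrow> \<not> (finite S \<and> card S \<le> m)"
proof
  assume "\<exists>cs. length cs = Suc m \<and> distinct cs \<and> set cs \<subseteq> S"
  then obtain cs where "length cs = Suc m" "distinct cs" "set cs \<subseteq> S" by blast
  then show "\<not> (finite S \<and> card S \<le> m)"
    using card_mono[of S "set cs"] by (auto simp: distinct_card)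
next
  assume "\<not> (finite S \<and> card S \<le> m)"
  then have "\<exists>T \<subseteq> S. finite T \<and> card T = Suc m"
    by (metis infinite_arbitrarily_large not_less_eq_eq obtain_subset_with_card_n)
  then obtain T where "T \<subseteq> S" "finite T" "card T = Suc m" by blast
  moreover from this(2) obtain cs where "set cs = T" "distinct cs"
    using finite_distinct_list by blast
  ultimately show "\<exists>cs. length cs = Suc m \<and> distinct cs \<and> set cs \<subseteq> S"
    using distinct_card by metis
qed

text \<open>Finiteness is part of the predicate because \<open>card\<close> is 0 on infinite sets.
  Together the two conditions say that no list of \<open>Suc m\<close> distinct solutions
  exists.\<close>

lemma definable_at_most:
  assumes "definable M X P" "finite X"
  shows "definable M (X - {x}) (\<lambda>e. finite {c. srt M c = fst x \<and> P (e(x := c))} \<and>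
    card {c. srt M c = fst x \<and> P (e(x := c))} \<le> m)"
proof -
  have "definable M (X - {x}) (\<lambda>e. \<not> (\<exists>cs. length cs = Suc m \<and> distinct cs \<and>
      (\<forall>c \<in> set cs. srt M c = fst x \<and> P (e(x := c)))))"
    using definable_not[OF definable_at_least[OF assms, of "{}" x "Suc m"]] by simp
  then show ?thesis
  proof (rule definable_cong)
    fix e
    show "\<not> (\<exists>cs. length cs = Suc m \<and> distinct cs \<and> (\<forall>c \<in> set cs. srt M c = fst x \<and> P (e(x := c)))) \<longleftrightarrow>
        finite {c. srt M c = fst x \<and> P (e(x := c))} \<and> card {c. srt M c = fst x \<and> P (e(x := c))} \<le> m"
      using at_least_iff_card[of m "{c. srt M c = fst x \<and> P (e(x := c))}"]
      unfolding subset_iff mem_Collect_eq by meson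
  qed
qed

section \<open>Automorphisms\<close>

lemma has_sort_ev:
  assumes "is_structure M" "sorted_env M e"
  shows "has_sort (sig M) t s \<Longrightarrow> srt M (ev M e t) = s"
proof (induction rule: has_sort.induct)
  case (2 f ss s ts)
  then have "srts M (map (ev M e) ts) = ss" by (simp add: list_all2_conv_all_nth list_eq_iff_nth_eq)
  then show ?case using 2 assms(1) unfolding is_structure_def ev.simps by blast
qed (use assms(2) in simp)

lemma automorphism_ev:
  assumes "automorphism M g" "is_structure M" "sorted_env M e"
  shows "has_sort (sig M) t s \<Longrightarrow> ev M (g \<circ> e) t = g (ev M e t)"
proof (induction rule: has_sort.induct)
  case (2 f ss s ts)
  then have "srts M (map (ev M e) ts) = ss"
    using has_sort_ev[OF assms(2,3)] by (auto simp: list_all2_conv_all_nth list_eq_iff_nth_eq)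
  then have "g (fint M f (map (ev M e) ts)) = fint M f (map g (map (ev M e) ts))"
    using 2 assms(1) unfolding automorphism_def by blast
  moreover have "map (ev M (g \<circ> e)) ts = map g (map (ev M e) ts)"
    using 2 by (auto simp: list_all2_conv_all_nth list_eq_iff_nth_eq comp_def)
  ultimately show ?case by (simp only: ev.simps)
qed simp

lemma automorphism_srt [simp]: "automorphism M g \<Longrightarrow> srt M (g a) = srt M a"
  by (simp add: automorphism_def)

text \<open>Injectivity of \<open>g\<close> handles equations and surjectivity the quantifier. Sorts
  enter because \<open>g\<close> respects symbols only at arguments of the declared sorts.\<close>

lemma automorphism_sat:
  assumes g: "automorphism M g" and M: "is_structure M"
  shows "wf_fm (sig M) \<phi> \<Longrightarrow> sorted_env M e \<Longrightarrow> sat M (g \<circ> e) \<phi> \<longleftrightarrow> sat M e \<phi>"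
proof (induction \<phi> arbitrary: e)
  case (Eq t u)
  then obtain s where "has_sort (sig M) t s" "has_sort (sig M) u s" by auto
  then have "ev M (g \<circ> e) t = g (ev M e t)" "ev M (g \<circ> e) u = g (ev M e u)"
    using automorphism_ev[OF g M Eq.prems(2)] by auto
  moreover have "inj g" using g by (simp add: automorphism_def bij_is_inj)
  ultimately show ?case by (simp only: sat.simps inj_eq)
next
  case (Rel r ts)
  then obtain ss where ss: "rsig (sig M) r = Some ss" "list_all2 (has_sort (sig M)) ts ss" by auto
  then have "srts M (map (ev M e) ts) = ss"
    using has_sort_ev[OF M Rel.prems(2)] by (auto simp: list_all2_conv_all_nth list_eq_iff_nth_eq)
  then have "rint M r (map g (map (ev M e) ts)) \<longleftrightarrow> rint M r (map (ev M e) ts)"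
    using ss(1) g unfolding automorphism_def by blast
  moreover have "map (ev M (g \<circ> e)) ts = map g (map (ev M e) ts)"
    using ss(2) automorphism_ev[OF g M Rel.prems(2)]
    by (auto simp: list_all2_conv_all_nth list_eq_iff_nth_eq)
  ultimately show ?case by (simp only: sat.simps)
next
  case (Ex x \<phi>)
  have upd: "sat M ((g \<circ> e)(x := g a)) \<phi> \<longleftrightarrow> sat M (e(x := a)) \<phi>" if "srt M a = fst x" for a
  proof -
    have "(g \<circ> e)(x := g a) = g \<circ> e(x := a)" by (auto simp: fun_eq_iff)
    moreover have "sat M (g \<circ> e(x := a)) \<phi> \<longleftrightarrow> sat M (e(x := a)) \<phi>"
      using Ex.IH[OF _ sorted_env_upd[OF Ex.prems(2) that]] Ex.prems(1) unfolding wf_fm.simps .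
    ultimately show ?thesis by (simp only:)
  qed
  have "surj g" using g by (simp add: automorphism_def bij_is_surj)
  then have "(\<exists>b. srt M b = fst x \<and> sat M ((g \<circ> e)(x := b)) \<phi>) \<longleftrightarrow>
      (\<exists>a. srt M (g a) = fst x \<and> sat M ((g \<circ> e)(x := g a)) \<phi>)"
    by (metis surjD)
  then show ?case using upd automorphism_srt[OF g] by (simp only: sat.simps) metis
qed auto

lemma automorphism_comp:
  assumes "automorphism M g" "automorphism M h"
  shows "automorphism M (g \<circ> h)"
proof -
  have "srts M (map h as) = srts M as" for as using assms(2) by simp
  then show ?thesis using assms unfolding automorphism_def
    by (auto simp: bij_comp simp del: map_map simp flip: map_map)
qed

lemma automorphism_inv:
  assumes g: "automorphism M g" and M: "is_structure M"
  shows "automorphism M (inv g)"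
proof -
  have bij: "bij g" using g by (simp add: automorphism_def)
  then have gi [simp]: "g (inv g a) = a" and ig [simp]: "inv g (g a) = a" for a
    by (simp_all add: bij_is_surj surj_f_inv_f bij_is_inj)
  have s: "srt M (inv g a) = srt M a" for a using automorphism_srt[OF g, of "inv g a"] by simp
  have m: "map g (map (inv g) as) = as" for as by (simp add: map_idI)
  have ss: "srts M (map (inv g) as) = srts M as" for as by (simp add: s)
  show ?thesis
    unfolding automorphism_def
  proof (intro conjI allI impI)
    show "bij (inv g)" by (rule bij_imp_bij_inv[OF bij])
    show "srt M (inv g a) = srt M a" for a by (rule s)
    show "inv g (fint M f as) = fint M f (map (inv g) as)" if "fsig (sig M) f = Some (srts M as, s)" for f as s
    proof -
      have "g (fint M f (map (inv g) as)) = fint M f as"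
        using g that m[of as] ss[of as] unfolding automorphism_def by metis
      then show ?thesis by (metis ig)
    qed
    show "rint M r (map (inv g) as) \<longleftrightarrow> rint M r as" if "rsig (sig M) r = Some (srts M as)" for r as
      using g that m[of as] ss[of as] unfolding automorphism_def by metis
  qed
qed

text \<open>The pointwise stabiliser of \<open>B\<close> in the automorphism group.\<close>

definition fixes_set :: "('f, 'r, 's, 'm) strct \<Rightarrow> 'm set \<Rightarrow> ('m \<Rightarrow> 'm) set" where
  "fixes_set M B = {h. automorphism M h \<and> (\<forall>b \<in> B. h b = b)}"

lemma fixes_setD:
  "h \<in> fixes_set M B \<Longrightarrow> automorphism M h" "h \<in> fixes_set M B \<Longrightarrow> b \<in> B \<Longrightarrow> h b = b"
  by (auto simp: fixes_set_def)

lemma fixes_set_comp: "g \<in> fixes_set M B \<Longrightarrow> h \<in> fixes_set M B \<Longrightarrow> g \<circ> h \<in> fixes_set M B"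
  by (auto simp: fixes_set_def automorphism_comp)

lemma fixes_set_inv:
  assumes "is_structure M" "g \<in> fixes_set M B"
  shows "inv g \<in> fixes_set M B"
proof -
  have "inj g" using assms(2) by (simp add: fixes_set_def automorphism_def bij_is_inj)
  then have "inv g b = b" if "b \<in> B" for b using assms(2) that by (metis fixes_setD(2) inv_f_f)
  then show ?thesis using assms automorphism_inv by (auto simp: fixes_set_def)
qed

definition orbit :: "('f, 'r, 's, 'm) strct \<Rightarrow> 'm set \<Rightarrow> 'm \<Rightarrow> 'm set" where
  "orbit M B c = (\<lambda>h. h c) ` fixes_set M B"

section \<open>Types and algebraic closure\<close>

locale fo_structure =
  fixes M :: "('f, 'r, 's, 'm) strct"
  assumes struct: "is_structure M"
begin

lemma ex_sorted_env: "\<exists>e. sorted_env M e"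
proof
  have "\<exists>a. srt M a = s" for s using struct unfolding is_structure_def by blast
  then have "srt M (SOME a. srt M a = s) = s" for s by (rule someI_ex)
  then show "sorted_env M (\<lambda>x. SOME a. srt M a = fst x)" by (rule sorted_envI)
qed

lemma env_of_tuple:
  assumes "distinct xs" "srts M as = map fst xs"
  obtains e where "sorted_env M e" "map e xs = as"
  using ex_sorted_env ex_sorted_env_extending[OF _ assms] by blast

lemma env_of_tuples:
  assumes "distinct (xs @ ys)" "srts M a = map fst xs" "srts M b = map fst ys"
  obtains e where "sorted_env M e" "map e xs = a" "map e ys = b"
proof -
  obtain e where e: "sorted_env M e" "map e (xs @ ys) = a @ b"
    using env_of_tuple[of "xs @ ys" "a @ b"] assms by auto
  moreover have "length a = length xs" using assms(2) by (metis length_map)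
  ultimately show ?thesis using that by simp
qed

lemma pholds_env:
  assumes "wf_pfm (sig M) (\<phi>, xs, ys)"
  shows "pholds M (\<phi>, xs, ys) (map e xs) (map e ys) \<longleftrightarrow> sat M e \<phi>"
  using assms holds_env[of \<phi> "xs @ ys" M e] by simp

lemma pholds_automorphism:
  assumes g: "automorphism M g" and p: "wf_pfm (sig M) p" "lsorts p = srts M a" "rsorts p = srts M b"
  shows "pholds M p (map g a) (map g b) \<longleftrightarrow> pholds M p a b"
proof -
  obtain \<phi> xs ys where [simp]: "p = (\<phi>, xs, ys)" by (cases p)
  obtain e where e: "sorted_env M e" "map e xs = a" "map e ys = b"
    using env_of_tuples[of xs ys a b] p by auto
  have "pholds M p (map (g \<circ> e) xs) (map (g \<circ> e) ys) \<longleftrightarrow> pholds M p (map e xs) (map e ys)"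
    using p(1) pholds_env automorphism_sat[OF g struct _ e(1)] by (metis \<open>p = _\<close> wf_pfm.simps)
  then show ?thesis using e(2,3) by (simp del: pholds.simps flip: map_map)
qed

lemma realises_tp_self: "realises M a (tp M a B)"
  by (auto simp: realises_def tp_def fms_over_def)

lemma realises_tp_automorphism:
  assumes "h \<in> fixes_set M C"
  shows "realises M (map h a) (tp M a C)"
  unfolding realises_def
proof safe
  fix \<phi> xs ys b
  assume pb: "((\<phi>, xs, ys), b) \<in> tp M a C"
  then have "map h b = b"
    using fixes_setD(2)[OF assms] by (intro map_idI) (auto simp: tp_def fms_over_def)
  moreover have "pholds M (\<phi>, xs, ys) (map h a) (map h b) \<longleftrightarrow> pholds M (\<phi>, xs, ys) a b"
    using pb fixes_setD(1)[OF assms]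
    by (intro pholds_automorphism) (auto simp del: pholds.simps simp: tp_def fms_over_def)
  ultimately show "pholds M (\<phi>, xs, ys) (map h a) b"
    using pb by (simp del: pholds.simps add: tp_def)
  show "lsorts (\<phi>, xs, ys) = srts M (map h a)"
    using pb fixes_setD(1)[OF assms] by (auto simp: tp_def fms_over_def)
qed

text \<open>Blocks may contain dummy variables, so \<open>Top\<close> in variables of the sorts of
  \<open>a\<close> belongs to the type, and realising it fixes the sorts.\<close>

lemma realises_tp_srts:
  assumes "realises M a' (tp M a C)"
  shows "srts M a' = srts M a"
proof -
  obtain zs :: "'s var list" where zs: "map fst zs = srts M a" "distinct zs"
    using fresh_list[of "{}" "srts M a"] by auto
  then have "((Top, zs, []), []) \<in> tp M a C"
    by (auto simp: tp_def fms_over_def holds_def)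
  then show ?thesis using assms zs by (auto simp: realises_def)
qed

text \<open>The type speaks about formulas with separate variables for the entries of
  \<open>a\<close> and parameters in \<open>C\<close>. Here the variables of \<open>\<phi>\<close>
  may take entries of \<open>a\<close> in any order and with repetition, so \<open>\<phi>\<close> is
  first renamed into that shape.\<close>

lemma realises_tp_transfer:
  assumes a': "realises M a' (tp M a C)" and wf: "wf_fm (sig M) \<phi>"
    and e: "sorted_env M e" and e': "sorted_env M e'"
    and ee': "\<And>x. x \<in> fv \<phi> \<Longrightarrow> e x \<in> C \<and> e' x = e x \<or> (\<exists>i < length a. e x = a ! i \<and> e' x = a' ! i)"
    and sat: "sat M e \<phi>"
  shows "sat M e' \<phi>"
proof -
  \<comment> \<open>Variables outside \<open>J\<close> become parameters; those in \<open>J\<close>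
    have to be read off the tuple, at the positions \<open>idx\<close>.\<close>
  define J where "J = {x \<in> fv \<phi>. \<not> (e x \<in> C \<and> e' x = e x)}"
  obtain idx where idx: "\<And>x. x \<in> J \<Longrightarrow> idx x < length a \<and> e x = a ! idx x \<and> e' x = a' ! idx x"
    using ee' unfolding J_def mem_Collect_eq by metis
  have srts: "srts M a' = srts M a" using realises_tp_srts[OF a'] .
  obtain zs :: "'s var list" where zs: "map fst zs = srts M a" "distinct zs" "set zs \<inter> fv \<phi> = {}"
    using fresh_list[of "fv \<phi>" "srts M a"] by auto
  have len: "length zs = length a" "length a' = length a"
    using zs(1) srts by (metis length_map)+
  define r where "r x = (if x \<in> J then zs ! idx x else x)" for x
  have zs_nth: "fst (zs ! i) = srt M (a ! i)" if "i < length a" for i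
    using that len arg_cong[OF zs(1), of "\<lambda>l. l ! i"] by simp
  have "fst (r x) = fst x" for x
  proof (cases "x \<in> J")
    case True
    then show ?thesis using zs_nth idx[OF True] e by (metis r_def sorted_envD)
  qed (simp add: r_def)
  then obtain \<phi>' where \<phi>': "wf_fm (sig M) \<phi>'" "fv \<phi>' \<subseteq> r ` fv \<phi>"
    "\<And>e. sorted_env M e \<Longrightarrow> sat M e \<phi>' \<longleftrightarrow> sat M (e \<circ> r) \<phi>"
    using definable_rename[OF definable_sat[OF wf] finite_fv, of r] unfolding definable_def by blast
  obtain ys where ys: "set ys = fv \<phi> - J" "distinct ys"
    using finite_distinct_list[of "fv \<phi> - J"] by auto
  have "r x \<in> set zs \<union> set ys" if "x \<in> fv \<phi>" for x
    using idx[of x] that ys(1) len(1) by (cases "x \<in> J") (auto simp: r_def)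
  then have "fv \<phi>' \<subseteq> set zs \<union> set ys" using \<phi>'(2) by blast
  then have p: "wf_pfm (sig M) (\<phi>', zs, ys)" using \<phi>'(1) ys zs(2,3) by auto
  \<comment> \<open>Serves both sides: \<open>E\<close> puts \<open>d\<close> on \<open>zs\<close>,
    keeps the parameters on \<open>ys\<close>, and recovers \<open>f\<close> when pulled back along
    \<open>r\<close>. It is used for \<open>a\<close> with \<open>e\<close> and for
    \<open>a'\<close> with \<open>e'\<close>.\<close>
  have tuple: "\<exists>E. sorted_env M E \<and> map E zs = d \<and> map E ys = map e ys \<and> (\<forall>x \<in> fv \<phi>. (E \<circ> r) x = f x)"
    if d: "srts M d = srts M a" and f: "sorted_env M f" "\<And>x. x \<in> J \<Longrightarrow> f x = d ! idx x"
      "\<And>x. x \<in> fv \<phi> - J \<Longrightarrow> f x = e x" for d f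
  proof -
    obtain E where E: "sorted_env M E" "map E zs = d" "\<forall>x. x \<notin> set zs \<longrightarrow> E x = f x"
      using ex_sorted_env_extending[OF f(1) zs(2), of d] zs(1) d by auto
    have Ef: "E x = f x" if "x \<in> fv \<phi>" for x using zs(3) E(3) that by blast
    have "E (zs ! i) = d ! i" if "i < length a" for i
      using E(2) len(1) that by auto
    then have "(E \<circ> r) x = f x" if "x \<in> fv \<phi>" for x
      using idx[of x] f(2)[of x] Ef[of x] that by (cases "x \<in> J") (auto simp: r_def)
    moreover have "E x = e x" if "x \<in> set ys" for x
      using ys(1) Ef[of x] f(3)[of x] that by simp
    ultimately show ?thesis using E by (intro exI[of _ E]) auto
  qed
  obtain E where E: "sorted_env M E" "map E zs = a" "map E ys = map e ys" "\<forall>x \<in> fv \<phi>. (E \<circ> r) x = e x"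
    using tuple[OF refl e] idx by blast
  obtain E' where E': "sorted_env M E'" "map E' zs = a'" "map E' ys = map e ys" "\<forall>x \<in> fv \<phi>. (E' \<circ> r) x = e' x"
  proof -
    have "e' x = e x" if "x \<in> fv \<phi> - J" for x using that by (simp add: J_def)
    then show thesis using tuple[OF srts e'] idx that by blast
  qed
  have "pholds M (\<phi>', zs, ys) a (map e ys)"
    using pholds_env[OF p, of E] \<phi>'(3)[OF E(1)] sat_cong[OF E(4), of M] sat unfolding E(2,3) by blast
  moreover have "set (map e ys) \<subseteq> C" using ys(1) by (auto simp: J_def)
  moreover have "srts M (map e ys) = map fst ys" using e by simp
  ultimately have "((\<phi>', zs, ys), map e ys) \<in> tp M a C"
    using p zs(1) by (simp add: tp_def fms_over_def)
  then have "pholds M (\<phi>', zs, ys) a' (map e ys)"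
    using a' by (auto simp del: pholds.simps simp: realises_def)
  then show ?thesis
    using pholds_env[OF p, of E'] \<phi>'(3)[OF E'(1)] sat_cong[OF E'(4), of M] unfolding E'(2,3) by blast
qed

text \<open>An introduction rule in terms of assignments: the variables other than \<open>x\<close>
  act as parameters, and the arrangement into blocks is done once, here.\<close>

lemma acl_envI:
  assumes P: "definable M X P" and "finite X" and e: "sorted_env M e" and B: "e ` (X - {x}) \<subseteq> B"
    and "P e" and fin: "finite {c. srt M c = fst x \<and> P (e(x := c))}"
  shows "e x \<in> acl M B"
proof -
  obtain \<phi> where \<phi>: "wf_fm (sig M) \<phi>" "fv \<phi> \<subseteq> X" "\<And>e. sorted_env M e \<Longrightarrow> sat M e \<phi> \<longleftrightarrow> P e"
    using P unfolding definable_def by blast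
  obtain ys where ys: "set ys = X - {x}" "distinct ys"
    using finite_distinct_list[of "X - {x}"] \<open>finite X\<close> by auto
  have p: "wf_pfm (sig M) (\<phi>, [x], ys)" using \<phi> ys by auto
  have upd: "pholds M (\<phi>, [x], ys) [c] (map e ys) \<longleftrightarrow> P (e(x := c))" if "srt M c = fst x" for c
  proof -
    have "map (e(x := c)) ys = map e ys" "map (e(x := c)) [x] = [c]" using ys by auto
    then show ?thesis
      using pholds_env[OF p, of "e(x := c)"] \<phi>(3)[OF sorted_env_upd[OF e that]] by metis
  qed
  have "((\<phi>, [x], ys), map e ys) \<in> fms_over M [srt M (e x)] B"
    using p e B ys by (auto simp: fms_over_def)
  moreover have "pholds M (\<phi>, [x], ys) [e x] (map e ys)"
    using upd[of "e x"] e \<open>P e\<close> by simp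
  moreover have "{c. srt M c = srt M (e x) \<and> pholds M (\<phi>, [x], ys) [c] (map e ys)}
      = {c. srt M c = fst x \<and> P (e(x := c))}"
    using upd e by (auto simp del: pholds.simps)
  ultimately show ?thesis using fin unfolding acl_def by fastforce
qed

lemma acl_envE:
  assumes "c \<in> acl M B"
  obtains \<phi> x ys e where "wf_fm (sig M) \<phi>" "distinct (x # ys)" "fv \<phi> \<subseteq> set (x # ys)"
    "sorted_env M e" "e x = c" "e ` set ys \<subseteq> B" "sat M e \<phi>"
    "finite {c. srt M c = fst x \<and> sat M (e(x := c)) \<phi>}"
proof -
  obtain \<phi> xs ys b where p: "((\<phi>, xs, ys), b) \<in> fms_over M [srt M c] B"
    "pholds M (\<phi>, xs, ys) [c] b" "finite {d. srt M d = srt M c \<and> pholds M (\<phi>, xs, ys) [d] b}"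
    using assms unfolding acl_def by auto
  then obtain x where [simp]: "xs = [x]" and x: "fst x = srt M c"
    by (auto simp: fms_over_def map_eq_Cons_conv)
  have wf: "wf_pfm (sig M) (\<phi>, [x], ys)" using p(1) by (simp add: fms_over_def)
  obtain e where e: "sorted_env M e" "map e [x] = [c]" "map e ys = b"
    using env_of_tuples[of "[x]" ys "[c]" b] p(1) wf by (auto simp: fms_over_def)
  have *: "pholds M (\<phi>, [x], ys) [d] b \<longleftrightarrow> sat M (e(x := d)) \<phi>" for d
  proof -
    have "map (e(x := d)) ys = b" "map (e(x := d)) [x] = [d]" using wf e by auto
    then show ?thesis using pholds_env[OF wf, of "e(x := d)"] by metis
  qed
  show ?thesis
  proof (rule that[of \<phi> x ys e])
    show "sat M e \<phi>" using *[of c] p(2) e(2) by (simp del: pholds.simps add: fun_upd_idem)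
    show "finite {c. srt M c = fst x \<and> sat M (e(x := c)) \<phi>}"
      using p(3) unfolding x by (simp only: * \<open>xs = _\<close>)
    show "e ` set ys \<subseteq> B" using p(1) e(3) by (auto simp: fms_over_def)
  qed (use wf e in auto)
qed

lemma acl_mono: "A \<subseteq> B \<Longrightarrow> acl M A \<subseteq> acl M B"
proof -
  assume "A \<subseteq> B"
  then have "fms_over M ss A \<subseteq> fms_over M ss B" for ss unfolding fms_over_def by blast
  then show ?thesis unfolding acl_def by (intro Collect_mono impI) (erule bexE, rule bexI, assumption, erule rev_subsetD)
qed

lemma acl_superset: "B \<subseteq> acl M B"
proof
  fix c
  assume c: "c \<in> B"
  let ?x = "(srt M c, 0 :: nat)" and ?y = "(srt M c, 1 :: nat)"
  obtain e where e: "sorted_env M e" "map e [?x, ?y] = [c, c]"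
    using env_of_tuple[of "[?x, ?y]" "[c, c]"] by auto
  have "definable M {?x, ?y} (\<lambda>e. e ?x = e ?y)" by (rule definable_eq) auto
  then have "e ?x \<in> acl M B" by (rule acl_envI) (use e c in auto)
  then show "c \<in> acl M B" using e by simp
qed

lemma acl_finite_character:
  assumes "c \<in> acl M B"
  obtains B0 where "finite B0" "B0 \<subseteq> B" "c \<in> acl M B0"
  using assms
proof (rule acl_envE)
  fix \<phi> x ys e
  assume *: "wf_fm (sig M) \<phi>" "distinct (x # ys)" "fv \<phi> \<subseteq> set (x # ys)"
    "sorted_env M e" "e x = c" "e ` set ys \<subseteq> B" "sat M e \<phi>"
    "finite {c. srt M c = fst x \<and> sat M (e(x := c)) \<phi>}"
  then have "e x \<in> acl M (e ` set ys)"
    by (intro acl_envI[OF definable_sat]) auto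
  with * show thesis by (intro that[of "e ` set ys"]) auto
qed

text \<open>Automorphisms fixing \<open>B\<close> preserve the solution set of every formula over
  \<open>B\<close>, so the orbit stays inside a finite one that contains \<open>c\<close>.\<close>

lemma finite_orbit:
  assumes "c \<in> acl M B"
  shows "finite (orbit M B c)"
  using assms
proof (rule acl_envE)
  fix \<phi> x ys e
  assume *: "wf_fm (sig M) \<phi>" "distinct (x # ys)" "fv \<phi> \<subseteq> set (x # ys)"
    "sorted_env M e" "e x = c" "e ` set ys \<subseteq> B" "sat M e \<phi>"
    "finite {c. srt M c = fst x \<and> sat M (e(x := c)) \<phi>}"
  have "srt M (h c) = fst x \<and> sat M (e(x := h c)) \<phi>" if h: "h \<in> fixes_set M B" for h
  proof
    show "srt M (h c) = fst x" using automorphism_srt[OF fixes_setD(1)[OF h]] * by auto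
    \<comment> \<open>The other values lie in \<open>B\<close>, so moving the value at
      \<open>x\<close> alone has the same effect on \<open>\<phi>\<close> as applying
      \<open>h\<close> throughout.\<close>
    have "\<forall>y \<in> fv \<phi>. (e(x := h c)) y = (h \<circ> e) y"
    proof
      fix y
      assume "y \<in> fv \<phi>"
      then have "y = x \<or> e y \<in> B" using *(3,6) by auto
      then show "(e(x := h c)) y = (h \<circ> e) y" using *(5) fixes_setD(2)[OF h] by auto
    qed
    then show "sat M (e(x := h c)) \<phi>"
      using automorphism_sat[OF fixes_setD(1)[OF h] struct *(1,4)] *(7) sat_cong by metis
  qed
  then have "orbit M B c \<subseteq> {c. srt M c = fst x \<and> sat M (e(x := c)) \<phi>}"
    by (auto simp: orbit_def)
  then show ?thesis using *(8) finite_subset by blast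
qed

text \<open>The members of a type do not share variable names, so they are renamed apart before they are conjoined.\<close>

lemma finite_type_definable:
  assumes "finite \<pi>" "\<pi> \<subseteq> tp M [c] B" and u: "fst u = srt M c"
  shows "\<exists>X P e. finite X \<and> definable M X P \<and> sorted_env M e \<and> e u = c \<and>
    e ` (X - {u}) \<subseteq> B \<and> P e \<and>
    (\<forall>d. srt M d = srt M c \<and> P (e(u := d)) \<longrightarrow> realises M [d] \<pi>)"
  using assms(1,2)
proof (induction \<pi> rule: finite_induct)
  case empty
  obtain e where "sorted_env M e" "map e [u] = [c]"
    using env_of_tuple[of "[u]" "[c]"] u by auto
  then show ?case
    using definable_True[of M "{}"] by (intro exI[of _ "{}"] exI[of _ "\<lambda>e. True"] exI[of _ e]) (auto simp: realises_def)
next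
  case (insert q \<pi>)
  obtain X P e where IH: "finite X" "definable M X P" "sorted_env M e" "e u = c"
    "e ` (X - {u}) \<subseteq> B" "P e" "\<And>d. srt M d = srt M c \<Longrightarrow> P (e(u := d)) \<Longrightarrow> realises M [d] \<pi>"
    using insert.IH insert.prems by blast
  obtain \<phi> xs ys b where q: "q = ((\<phi>, xs, ys), b)" by (cases q) auto
  have qtp: "((\<phi>, xs, ys), b) \<in> tp M [c] B" using insert.prems q by auto
  then obtain x where xs [simp]: "xs = [x]" and x: "fst x = srt M c"
    by (auto simp: tp_def fms_over_def map_eq_Cons_conv)
  have wf: "wf_pfm (sig M) (\<phi>, [x], ys)" and b: "srts M b = map fst ys" "set b \<subseteq> B"
    and holds: "pholds M (\<phi>, [x], ys) [c] b"
    using qtp by (auto simp: tp_def fms_over_def)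
  obtain zs where zs: "map fst zs = map fst ys" "distinct zs" "set zs \<inter> insert u X = {}"
    using fresh_list[of "insert u X" "map fst ys"] IH(1) by auto
  have len: "length zs = length ys" using zs(1) by (metis length_map)
  \<comment> \<open>The variable \<open>x\<close> of the new formula is identified with the common
    \<open>u\<close>; its parameter variables go to the fresh \<open>zs\<close>, away from the
    earlier formulas.\<close>
  define r where "r y = (if y = x then u else case map_of (zip ys zs) y of Some z \<Rightarrow> z | None \<Rightarrow> y)" for y
  have r_ys: "map r ys = zs"
  proof (rule nth_equalityI)
    fix i assume i: "i < length (map r ys)"
    then have "ys ! i \<noteq> x" using wf by auto
    moreover have "map_of (zip ys zs) (ys ! i) = Some (zs ! i)"
      using i wf len by (intro map_of_zip_nth) auto
    ultimately show "map r ys ! i = zs ! i" using i by (simp add: r_def)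
  qed (simp add: len)
  have r_x: "r x = u" by (simp add: r_def)
  have r: "fst (r y) = fst y" for y
  proof -
    consider "y = x" | "y \<in> set ys" | "y \<noteq> x" "y \<notin> set ys" by blast
    then show ?thesis
    proof cases
      case 1
      then show ?thesis using x u by (simp add: r_x)
    next
      case 2
      then obtain i where i: "i < length ys" "y = ys ! i" by (metis in_set_conv_nth)
      then have "r y = zs ! i" using r_ys by auto
      then show ?thesis using i len arg_cong[OF zs(1), of "\<lambda>l. l ! i"] by simp
    next
      case 3
      then have "map_of (zip ys zs) y = None" using len by (simp add: map_of_zip_is_None)
      then show ?thesis using 3 by (simp add: r_def)
    qed
  qed
  \<comment> \<open>Only the fresh \<open>zs\<close> receive new values, so the earlier condition
    \<open>P\<close> keeps its truth value.\<close>
  obtain E where E: "sorted_env M E" "map E zs = b" "\<forall>y. y \<notin> set zs \<longrightarrow> E y = e y"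
    using ex_sorted_env_extending[OF IH(3) zs(2), of b] zs(1) b(1) by auto
  have E_out: "E y = e y" if "y \<in> insert u X" for y using E(3) zs(3) that by blast
  have Eu: "E u = c" using E_out[of u] IH(4) by simp
  define Q where "Q e \<longleftrightarrow> P e \<and> sat M (e \<circ> r) \<phi>" for e
  have sat_r: "sat M (E(u := d) \<circ> r) \<phi> \<longleftrightarrow> pholds M (\<phi>, [x], ys) [d] b" for d
  proof -
    have "map (E(u := d) \<circ> r) ys = map (E(u := d)) zs" using r_ys by (metis map_map)
    also have "\<dots> = b" using E(2) zs(3) by auto
    finally show ?thesis using pholds_env[OF wf, of "E(u := d) \<circ> r"] r_x by (simp del: pholds.simps)
  qed
  have P_E: "P (E(u := d)) \<longleftrightarrow> P (e(u := d))" if "srt M d = srt M c" for d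
    using that by (intro definable_cong_env[OF IH(2)] sorted_env_upd E IH) (use E_out u in auto)
  have defQ: "definable M (X \<union> {u} \<union> set zs) Q"
    unfolding Q_def[abs_def]
  proof (rule definable_conj)
    show "definable M (X \<union> {u} \<union> set zs) P" by (rule definable_mono[OF IH(2)]) auto
    have "definable M (r ` (set (x # ys))) (\<lambda>e. sat M (e \<circ> r) \<phi>)"
      using wf by (intro definable_rename r definable_mono[OF definable_sat]) auto
    moreover have "r ` (set (x # ys)) = insert u (set zs)"
      using r_x r_ys by (metis list.simps(9) list.set_map list.simps(15))
    ultimately show "definable M (X \<union> {u} \<union> set zs) (\<lambda>e. sat M (e \<circ> r) \<phi>)"
      by (auto intro: definable_mono)
  qed
  have img: "E ` (X \<union> {u} \<union> set zs - {u}) \<subseteq> B"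
  proof -
    have "E ` (X - {u}) = e ` (X - {u})" using E_out by (intro image_cong) auto
    moreover have "E ` set zs = set b" using E(2) by auto
    ultimately show ?thesis using IH(5) b(2) by blast
  qed
  have QE: "Q E"
    using P_E[of c] IH(3,4,6) sat_r[of c] holds Eu unfolding Q_def by (simp del: pholds.simps add: fun_upd_idem)
  have real: "realises M [d] (insert q \<pi>)" if "srt M d = srt M c" "Q (E(u := d))" for d
    using that P_E[OF that(1)] IH(7)[OF that(1)] sat_r[of d] x unfolding Q_def realises_def q
    by (auto simp del: pholds.simps)
  show ?case
  proof (intro exI conjI allI impI)
    show "finite (X \<union> {u} \<union> set zs)" using IH(1) by simp
    show "realises M [d] (insert q \<pi>)" if "srt M d = srt M c \<and> Q (E(u := d))" for d
      using that real by blast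
  qed (use defQ E(1) Eu img QE in simp_all)
qed

end

text \<open>The lists are split by length, and each length is bounded through a product. The bound
  is an infinite \<open>Y\<close> rather than \<open>S\<close> because \<open>S\<close> may be
  finite.\<close>

lemma card_of_lists_ordLeq:
  assumes Y: "infinite Y" and S: "|S| \<le>o |Y|"
  shows "|lists S| \<le>o |Y|"
proof -
  have fY: "infinite (Field |Y| )" using Y by (simp add: Field_card_of)
  have "|{xs \<in> lists S. length xs = n}| \<le>o |Y|" for n
  proof (induction n)
    case 0
    have "finite {xs \<in> lists S. length xs = 0}"
      by (rule finite_subset[of _ "{[]}"]) auto
    then show ?case using Y card_of_ordLeq_infinite ordLeq_total[OF card_of_Well_order card_of_Well_order] by blast
  next
    case (Suc n)
    have "{xs \<in> lists S. length xs = Suc n} \<subseteq> (\<lambda>(x, xs). x # xs) ` (S \<times> {xs \<in> lists S. length xs = n})"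
    proof
      fix ys
      assume ys: "ys \<in> {xs \<in> lists S. length xs = Suc n}"
      then obtain x xs where "ys = x # xs" by (cases ys) auto
      with ys show "ys \<in> (\<lambda>(x, xs). x # xs) ` (S \<times> {xs \<in> lists S. length xs = n})"
        by (intro image_eqI[of _ _ "(x, xs)"]) auto
    qed
    then have "|{xs \<in> lists S. length xs = Suc n}| \<le>o |S \<times> {xs \<in> lists S. length xs = n}|"
      by (rule ordLeq_transitive[OF card_of_mono1 card_of_image])
    also have "|S \<times> {xs \<in> lists S. length xs = n}| \<le>o |Y|"
      using card_of_Times_ordLeq_infinite_Field[OF fY S Suc.IH card_of_Card_order] .
    finally show ?case .
  qed
  moreover have "|UNIV :: nat set| \<le>o |Y|" using Y infinite_iff_card_of_nat by blast
  ultimately have "|\<Union>n. {xs \<in> lists S. length xs = n}| \<le>o |Y|"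
    by (intro card_of_UNION_ordLeq_infinite[OF Y]) auto
  moreover have "lists S = (\<Union>n. {xs \<in> lists S. length xs = n})" by auto
  ultimately show ?thesis by (simp only:)
qed

section \<open>Smallness, homogeneity and orbits in the big model\<close>

locale monster = fo_structure M for M :: "('f, 'r, 's, 'm) strct" +
  fixes \<kappa> :: "'k rel"
  assumes card: "Card_order \<kappa>" "|{\<phi>. wf_fm (sig M) \<phi>}| <o \<kappa>"
    and saturated: "saturated M \<kappa>"
    and homogeneous: "strongly_homogeneous M \<kappa>"
begin

text \<open>Partitioned formulas carry lists of variables, so counting them needs the variables
  bounded as well. An equation \<open>Eq (Var x) (Var x)\<close> is well formed in every
  signature.\<close>

lemma variables_le_formulas: "|UNIV :: 's var set| \<le>o |{\<phi>. wf_fm (sig M) \<phi>}|"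
proof (rule card_of_ordLeqI)
  show "inj_on (\<lambda>x. Eq (Var x) (Var x)) (UNIV :: 's var set)" by (rule inj_onI) simp
  show "Eq (Var x) (Var x) \<in> {\<phi>. wf_fm (sig M) \<phi>}" for x
    using has_sort.intros(1)[of "sig M" x] by auto
qed

lemma infinite_variables: "infinite (UNIV :: 's var set)"
  using infinite_UNIV_nat finite_imageD finite_subset by (simp add: finite_prod)

lemma infinite_formulas: "infinite {\<phi>. wf_fm (sig M) \<phi>}"
  using card_of_ordLeq_infinite[OF variables_le_formulas infinite_variables] .

lemma infinite_kappa: "infinite (Field \<kappa>)"
proof -
  have "|{\<phi>. wf_fm (sig M) \<phi>}| \<le>o |Field \<kappa>|"
    using card(2) card_of_Field_ordIso[OF card(1)] ordIso_symmetric ordLess_imp_ordLeq ordLeq_ordIso_trans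
    by blast
  then show ?thesis using card_of_ordLeq_infinite infinite_formulas by blast
qed

lemma small_subset: "small \<kappa> B \<Longrightarrow> A \<subseteq> B \<Longrightarrow> small \<kappa> A"
  unfolding small_def using card_of_mono1 ordLeq_ordLess_trans by blast

lemma small_Un: "small \<kappa> A \<Longrightarrow> small \<kappa> B \<Longrightarrow> small \<kappa> (A \<union> B)"
  unfolding small_def by (rule card_of_Un_ordLess_infinite_Field[OF infinite_kappa card(1)])

lemma small_finite: "finite A \<Longrightarrow> small \<kappa> A"
  unfolding small_def
  by (rule finite_ordLess_infinite[OF card_of_Well_order])
    (use card(1) infinite_kappa in \<open>simp_all add: card_order_on_well_order_on Field_card_of\<close>)

text \<open>The closure is covered by finite solution sets, indexed by partitioned formulas with
  parameter tuples from \<open>B\<close>.\<close>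

lemma small_acl:
  assumes "small \<kappa> B"
  shows "small \<kappa> (acl M B)"
proof -
  define F where "F = {\<phi>. wf_fm (sig M) \<phi>}"
  \<comment> \<open>Infinite even if \<open>B\<close> is finite, so that finite products and lists
    do not exceed its cardinality, and still below \<open>\<kappa>\<close>.\<close>
  define Y where "Y = F <+> B"
  have F_Y: "|F| \<le>o |Y|" and B_Y: "|B| \<le>o |Y|"
    unfolding Y_def by (rule card_of_Plus1, rule card_of_Plus2)
  have infY: "infinite Y" using card_of_ordLeq_infinite[OF F_Y] infinite_formulas F_def by blast
  have Y: "|Y| <o \<kappa>"
    unfolding Y_def by (rule card_of_Plus_ordLess_infinite_Field[OF infinite_kappa card(1)])
      (use card(2) assms in \<open>auto simp: F_def small_def\<close>)
  have cY: "Card_order |Y|" and fY: "infinite (Field |Y| )"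
    using infY card_of_Card_order by (simp_all add: Field_card_of)
  define I where "I = (F \<times> lists (UNIV :: 's var set) \<times> lists (UNIV :: 's var set)) \<times> lists B"
  have I: "|I| \<le>o |Y|"
    unfolding I_def
    by (intro card_of_Times_ordLeq_infinite_Field[OF fY _ _ cY] card_of_lists_ordLeq[OF infY] F_Y B_Y
        ordLeq_transitive[OF variables_le_formulas[folded F_def] F_Y])
  \<comment> \<open>Infinite solution sets are replaced by the empty set, so that every member of
    the family is finite.\<close>
  define S where "S i = (let R = {c. \<exists>s. lsorts (fst i) = [s] \<and> srt M c = s \<and> pholds M (fst i) [c] (snd i)}
    in if finite R then R else {})" for i
  have "|S i| \<le>o |Y|" for i
  proof -
    have "finite (S i)" by (simp add: S_def Let_def)
    then show ?thesis using infY card_of_ordLeq_infinite ordLeq_total[OF card_of_Well_order card_of_Well_order] by blast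
  qed
  then have "|\<Union>i\<in>I. S i| \<le>o |Y|"
    using card_of_UNION_ordLeq_infinite_Field[OF fY cY I] by blast
  moreover have "acl M B \<subseteq> (\<Union>i\<in>I. S i)"
  proof
    fix c
    assume "c \<in> acl M B"
    then obtain p b where p: "(p, b) \<in> fms_over M [srt M c] B" "pholds M p [c] b"
      "finite {d. srt M d = srt M c \<and> pholds M p [d] b}"
      unfolding acl_def by blast
    moreover have "{d. \<exists>s. lsorts p = [s] \<and> srt M d = s \<and> pholds M p [d] b}
        = {d. srt M d = srt M c \<and> pholds M p [d] b}"
      using p(1) by (auto simp: fms_over_def)
    ultimately have "c \<in> S (p, b)" by (simp add: S_def)
    moreover have "(p, b) \<in> I"
      using p(1) by (cases p) (auto simp: I_def F_def fms_over_def)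
    ultimately show "c \<in> (\<Union>i\<in>I. S i)" by blast
  qed
  ultimately show ?thesis
    using Y unfolding small_def by (meson card_of_mono1 ordLeq_ordLess_trans ordLeq_transitive)
qed

text \<open>The map that is the identity on \<open>C\<close> and sends \<open>a\<close> to
  \<open>a'\<close> is elementary on a small set, so strong homogeneity extends it.\<close>

lemma realises_tp_homogeneous:
  assumes C: "small \<kappa> C" and a': "realises M a' (tp M a C)"
  obtains h where "h \<in> fixes_set M C" "map h a = a'"
proof -
  have srts: "srts M a' = srts M a" using realises_tp_srts[OF a'] .
  then have len: "length a' = length a" by (metis length_map)
  have srt_nth: "srt M (a' ! i) = srt M (a ! i)" if "i < length a" for i
    using arg_cong[OF srts, of "\<lambda>l. l ! i"] that len by simp
  \<comment> \<open>Entries of \<open>a\<close> may repeat or lie in \<open>C\<close>. Transferring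
    the equation between \<open>?x\<close> and \<open>?y\<close> shows that the map is well defined
    all the same.\<close>
  have wd: "a' ! i = d'" if "i < length a" "d \<in> C \<and> d' = d \<or> (\<exists>j < length a. d = a ! j \<and> d' = a' ! j)"
    "a ! i = d" for i d d'
  proof -
    let ?x = "(srt M d, 0 :: nat)" and ?y = "(srt M d, 1 :: nat)"
    have d': "srt M d' = srt M d" using that(2) srt_nth by auto
    have ai: "srt M (a ! i) = srt M d" "srt M (a' ! i) = srt M d" using that srt_nth by auto
    obtain e where e: "sorted_env M e" "map e [?x, ?y] = [a ! i, d]"
      using env_of_tuple[of "[?x, ?y]" "[a ! i, d]"] ai by auto
    obtain e' where e': "sorted_env M e'" "map e' [?x, ?y] = [a' ! i, d']"
      using env_of_tuple[of "[?x, ?y]" "[a' ! i, d']"] ai d' by auto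
    have "sat M e' (Eq (Var ?x) (Var ?y))"
    proof (rule realises_tp_transfer[OF a' _ e(1) e'(1)])
      show "wf_fm (sig M) (Eq (Var ?x) (Var ?y))"
        using has_sort.intros(1)[of "sig M" ?x] has_sort.intros(1)[of "sig M" ?y] by auto
      show "e x \<in> C \<and> e' x = e x \<or> (\<exists>i < length a. e x = a ! i \<and> e' x = a' ! i)"
        if "x \<in> fv (Eq (Var ?x) (Var ?y))" for x
      proof -
        have "x = ?x \<or> x = ?y" using that by auto
        then show ?thesis
          using e(2) e'(2) \<open>i < length a\<close> \<open>d \<in> C \<and> d' = d \<or> _\<close> by auto
      qed
      show "sat M e (Eq (Var ?x) (Var ?y))" using e(2) that(3) by simp
    qed
    then show ?thesis using e'(2) by auto
  qed
  define g where "g c = (if c \<in> C then c else a' ! (SOME i. i < length a \<and> a ! i = c))" for c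
  have g: "c \<in> C \<and> g c = c \<or> (\<exists>i < length a. c = a ! i \<and> g c = a' ! i)" if c: "c \<in> C \<union> set a" for c
  proof (cases "c \<in> C")
    case False
    then have "\<exists>i. i < length a \<and> a ! i = c" using c by (auto simp: in_set_conv_nth)
    then have "(SOME i. i < length a \<and> a ! i = c) < length a \<and> a ! (SOME i. i < length a \<and> a ! i = c) = c"
      by (rule someI_ex)
    then show ?thesis using False by (auto simp: g_def)
  qed (simp add: g_def)
  have g_srt: "srt M (g c) = srt M c" if "c \<in> C \<union> set a" for c
    using g[OF that] srt_nth by auto
  have transfer: "holds M \<phi> xs (map g as)" if *: "wf_fm (sig M) \<phi>" "distinct xs" "fv \<phi> \<subseteq> set xs"
    "map fst xs = srts M as" "set as \<subseteq> C \<union> set a" "holds M \<phi> xs as" for \<phi> xs as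
  proof -
    obtain e where e: "sorted_env M e" "map e xs = as"
      using env_of_tuple[of xs as] * by auto
    have "srts M (map g as) = map fst xs" using g_srt *(4,5) by auto
    then obtain e' where e': "sorted_env M e'" "map e' xs = map g as"
      using env_of_tuple[of xs "map g as"] *(2) by auto
    have "sat M e' \<phi>"
    proof (rule realises_tp_transfer[OF a' *(1) e(1) e'(1)])
      fix x
      assume "x \<in> fv \<phi>"
      then have x: "x \<in> set xs" using *(3) by auto
      then have "e x \<in> set as" using e(2) by auto
      moreover have "e' x = g (e x)" using x e(2) e'(2) by (metis (mono_tags, lifting) list.map_comp map_eq_conv comp_apply)
      ultimately show "e x \<in> C \<and> e' x = e x \<or> (\<exists>i < length a. e x = a ! i \<and> e' x = a' ! i)"
        using g[of "e x"] *(5) by auto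
    next
      show "sat M e \<phi>" using holds_env[OF *(3), of M e] *(6) e(2) by simp
    qed
    then show ?thesis using holds_env[OF *(3), of M e'] e'(2) by simp
  qed
  have "elementary_on M (C \<union> set a) g"
    unfolding elementary_on_def
  proof (intro conjI ballI allI impI)
    show "srt M (g c) = srt M c" if "c \<in> C \<union> set a" for c using g_srt[OF that] .
    fix \<phi> xs as
    assume *: "wf_fm (sig M) \<phi> \<and> distinct xs \<and> fv \<phi> \<subseteq> set xs \<and> map fst xs = srts M as \<and> set as \<subseteq> C \<union> set a"
    \<comment> \<open>\<open>transfer\<close> gives one direction; the other is its instance for the
      negation.\<close>
    show "holds M \<phi> xs (map g as) \<longleftrightarrow> holds M \<phi> xs as"
      using transfer[of \<phi> xs as] transfer[of "Neg \<phi>" xs as] * by (auto simp: holds_def)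
  qed
  moreover have "small \<kappa> (C \<union> set a)" by (intro small_Un C small_finite) simp
  ultimately obtain h where h: "automorphism M h" "\<forall>c \<in> C \<union> set a. h c = g c"
    using homogeneous unfolding strongly_homogeneous_def by blast
  have "h \<in> fixes_set M C" using h by (auto simp: fixes_set_def g_def)
  moreover have "map h a = a'"
  proof (rule nth_equalityI)
    fix i
    assume "i < length (map h a)"
    then have i: "i < length a" by simp
    then have "a' ! i = g (a ! i)" using wd[OF i g[of "a ! i"]] by auto
    then show "map h a ! i = a' ! i" using h(2) i by auto
  qed (simp add: len)
  ultimately show thesis by (rule that)
qed

text \<open>If the orbit were finite, the type of \<open>c\<close> over \<open>B\<close> together
  with formulas excluding the orbit would be finitely satisfiable. Saturation would realise it
  outside the orbit, while homogeneity puts every realisation of the type inside.\<close>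

lemma infinite_orbit:
  assumes B: "small \<kappa> B" and c: "c \<notin> acl M B"
  shows "infinite (orbit M B c)"
proof
  assume fin: "finite (orbit M B c)"
  let ?x = "(srt M c, 0 :: nat)" and ?y = "(srt M c, 1 :: nat)"
  define F where "F = {f \<in> orbit M B c. srt M f = srt M c}"
  define neq :: "'m \<Rightarrow> ('f, 'r, 's) pfm \<times> 'm list"
    where "neq f = ((Neg (Eq (Var ?x) (Var ?y)), [?x], [?y]), [f])" for f
  have neq_holds: "pholds M (Neg (Eq (Var ?x) (Var ?y)), [?x], [?y]) [d] [f] \<longleftrightarrow> d \<noteq> f" for d f
    by (simp add: holds_def)
  have wf: "wf_fm (sig M) (Neg (Eq (Var ?x) (Var ?y)))"
    using has_sort.intros(1)[of "sig M" ?x] has_sort.intros(1)[of "sig M" ?y] by auto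
  define \<pi> where "\<pi> = tp M [c] B \<union> neq ` F"
  have "\<pi> \<subseteq> fms_over M [srt M c] (B \<union> F)"
    using wf by (auto simp: \<pi>_def neq_def F_def tp_def fms_over_def simp del: wf_fm.simps)
  moreover have "small \<kappa> (B \<union> F)"
    by (intro small_Un B small_finite) (simp add: F_def fin)
  moreover have "\<exists>d. srt M d = srt M c \<and> realises M [d] \<pi>0" if \<pi>0: "\<pi>0 \<subseteq> \<pi>" "finite \<pi>0" for \<pi>0
  proof -
    \<comment> \<open>The part of \<open>\<pi>0\<close> from the type is condensed into one
      definable condition over \<open>B\<close> that holds of \<open>c\<close>. As \<open>c\<close>
      is not algebraic, it has infinitely many solutions, hence one outside the finite
      \<open>F\<close>.\<close>
    obtain X P e where e: "finite X" "definable M X P" "sorted_env M e" "e ?x = c"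
      "e ` (X - {?x}) \<subseteq> B" "P e"
      "\<forall>d. srt M d = srt M c \<and> P (e(?x := d)) \<longrightarrow> realises M [d] (\<pi>0 \<inter> tp M [c] B)"
      using finite_type_definable[of "\<pi>0 \<inter> tp M [c] B" c B ?x] \<pi>0(2) by auto
    have "infinite {d. srt M d = srt M c \<and> P (e(?x := d))}"
      using acl_envI[OF e(2,1,3,5,6)] c unfolding e(4) fst_conv by blast
    moreover have "finite F" using fin by (simp add: F_def)
    ultimately have "\<not> {d. srt M d = srt M c \<and> P (e(?x := d))} \<subseteq> F" using finite_subset by blast
    then obtain d where d: "srt M d = srt M c" "P (e(?x := d))" "d \<notin> F" by blast
    then have "realises M [d] (\<pi>0 \<inter> tp M [c] B)" using e(7) by blast
    moreover have "realises M [d] (neq ` F)"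
      using d(1,3) neq_holds by (auto simp: realises_def neq_def simp del: pholds.simps)
    ultimately have "realises M [d] \<pi>0"
      using \<pi>0(1) unfolding realises_def \<pi>_def by blast
    then show ?thesis using d(1) by blast
  qed
  ultimately obtain d where d: "srt M d = srt M c" "realises M [d] \<pi>"
    using saturated unfolding saturated_def by meson
  then have "realises M [d] (tp M [c] B)" by (auto simp: realises_def \<pi>_def)
  then obtain h where h: "h \<in> fixes_set M B" "map h [c] = [d]"
    using realises_tp_homogeneous[OF B] by blast
  then have "d \<in> F" using d(1) by (auto simp: F_def orbit_def)
  then have "pholds M (Neg (Eq (Var ?x) (Var ?y)), [?x], [?y]) [d] [d]"
    using d(2) unfolding realises_def \<pi>_def neq_def by blast
  then show False using neq_holds by blast
qed

lemma acl_iff_finite_orbit: "small \<kappa> B \<Longrightarrow> c \<in> acl M B \<longleftrightarrow> finite (orbit M B c)"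
  using finite_orbit infinite_orbit by blast

text \<open>A count of orbits: finitely many parameters from \<open>acl M B\<close> have finitely
  many joint images over \<open>B\<close>, and above each of these \<open>c\<close> has finitely
  many images. Smallness is used to return from a finite orbit to \<open>acl\<close>.\<close>

lemma acl_idem:
  assumes B: "small \<kappa> B"
  shows "acl M (acl M B) = acl M B"
proof
  show "acl M (acl M B) \<subseteq> acl M B"
  proof
    fix c
    assume "c \<in> acl M (acl M B)"
    then obtain A where A: "finite A" "A \<subseteq> acl M B" "c \<in> acl M A" by (rule acl_finite_character)
    obtain as where as: "set as = A" using finite_list[OF A(1)] by blast
    have "finite (\<Union>a\<in>A. orbit M B a)" using A(1,2) finite_orbit by auto
    then have "finite {bs. set bs \<subseteq> (\<Union>a\<in>A. orbit M B a) \<and> length bs = length as}"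
      by (rule finite_lists_length_eq)
    moreover have "(\<lambda>h. map h as) ` fixes_set M B
        \<subseteq> {bs. set bs \<subseteq> (\<Union>a\<in>A. orbit M B a) \<and> length bs = length as}"
      unfolding orbit_def using as by fastforce
    ultimately have fin: "finite ((\<lambda>h. map h as) ` fixes_set M B)" using finite_subset by blast
    \<comment> \<open>Two automorphisms with the same effect on \<open>as\<close> differ by one that
      fixes \<open>A\<close>, so the fibre lies in a translate of the finite orbit of
      \<open>c\<close> over \<open>A\<close>.\<close>
    have fib: "finite ((\<lambda>h. h c) ` {h \<in> fixes_set M B. map h as = bs})" for bs
    proof (cases "\<exists>g \<in> fixes_set M B. map g as = bs")
      case True
      then obtain g where g: "g \<in> fixes_set M B" "map g as = bs" by blast
      have "h c \<in> g ` orbit M A c" if h: "h \<in> fixes_set M B" "map h as = bs" for h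
      proof -
        have bij: "bij g" using g(1) by (simp add: fixes_set_def automorphism_def)
        have "(inv g \<circ> h) a = a" if "a \<in> A" for a
        proof -
          have "h a = g a" using that as g(2) h(2) by auto
          then show ?thesis using bij by (simp add: bij_is_inj)
        qed
        moreover have "automorphism M (inv g \<circ> h)"
          using fixes_set_comp[OF fixes_set_inv[OF struct g(1)] h(1)] by (simp add: fixes_set_def)
        ultimately have "(inv g \<circ> h) c \<in> orbit M A c"
          unfolding orbit_def fixes_set_def by blast
        moreover have "g ((inv g \<circ> h) c) = h c" using bij by (simp add: bij_is_surj surj_f_inv_f)
        ultimately show ?thesis by (metis imageI)
      qed
      then have "(\<lambda>h. h c) ` {h \<in> fixes_set M B. map h as = bs} \<subseteq> g ` orbit M A c" by blast
      then show ?thesis using finite_orbit[OF A(3)] finite_subset by blast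
    next
      case False
      then have "{h \<in> fixes_set M B. map h as = bs} = {}" by blast
      then show ?thesis by (simp only: image_empty finite.emptyI)
    qed
    have "orbit M B c = (\<Union>bs \<in> (\<lambda>h. map h as) ` fixes_set M B.
        (\<lambda>h. h c) ` {h \<in> fixes_set M B. map h as = bs})"
      by (auto simp: orbit_def)
    then have "finite (orbit M B c)" using finite_UN_I[OF fin fib] by (simp only:)
    then show "c \<in> acl M B" using acl_iff_finite_orbit[OF B] by blast
  qed
qed (rule acl_superset)

end

section \<open>The pairs in \<open>\<Xi>\<^sub>M\<close>\<close>

lemma conj_list_simps [simp]:
  "sat M e (conj_list \<phi>s) \<longleftrightarrow> (\<forall>\<phi> \<in> set \<phi>s. sat M e \<phi>)"
  "wf_fm L (conj_list \<phi>s) \<longleftrightarrow> (\<forall>\<phi> \<in> set \<phi>s. wf_fm L \<phi>)"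
  "fv (conj_list \<phi>s) = (\<Union>\<phi> \<in> set \<phi>s. fv \<phi>)"
  "conjuncts (conj_list \<phi>s) = (\<Union>\<phi> \<in> set \<phi>s. conjuncts \<phi>)"
  by (induction \<phi>s) (auto simp: conj_list_def)

text \<open>The reason why identifying formulas with the same conjuncts is harmless.\<close>

lemma sat_conjuncts: "sat M e \<phi> \<longleftrightarrow> (\<forall>\<chi> \<in> conjuncts \<phi>. sat M e \<chi>)"
  by (induction \<phi>) auto

lemma set_index_pairs: "set (index_pairs k) = {(i, j). i < j \<and> j < k}"
  by (auto simp: index_pairs_def)

lemma sat_tuple_eq:
  "length xs = length ys \<Longrightarrow> sat M e (tuple_eq xs ys) \<longleftrightarrow> map e xs = map e ys"
  unfolding tuple_eq_def by (induction xs ys rule: list_induct2) auto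

lemma wf_tuple_eq: "map fst xs = map fst ys \<Longrightarrow> wf_fm L (tuple_eq xs ys)"
  unfolding tuple_eq_def
  by (auto simp: in_set_zip list_eq_iff_nth_eq) (metis has_sort.intros(1) fst_conv)

lemma fv_tuple_eq: "fv (tuple_eq xs ys) \<subseteq> set xs \<union> set ys"
  unfolding tuple_eq_def by (auto dest: set_zip_leftD set_zip_rightD)

lemma map_omit_nth: "map f (omit_nth n xs) = omit_nth n (map f xs)"
  by (simp add: omit_nth_def take_map drop_map)

lemma set_omit_nth_subset: "set (omit_nth n xs) \<subseteq> set xs"
  by (auto simp: omit_nth_def dest: in_set_takeD in_set_dropD)

lemma omit_nth_update [simp]: "omit_nth n (xs[n := c]) = omit_nth n xs"
  by (simp add: omit_nth_def)

lemma nth_in_omit_nth: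
  assumes "i < length xs" "i \<noteq> n"
  shows "xs ! i \<in> set (omit_nth n xs)"
proof (cases "i < n")
  case True
  then have "xs ! i = take n xs ! i" "i < length (take n xs)" using assms by auto
  then show ?thesis unfolding omit_nth_def by (metis UnI1 nth_mem set_append)
next
  case False
  then have "xs ! i = drop (Suc n) xs ! (i - Suc n)" "i - Suc n < length (drop (Suc n) xs)"
    using assms by auto
  then show ?thesis unfolding omit_nth_def by (metis UnI2 nth_mem set_append)
qed

lemma map_eq_update:
  assumes "n < length b" "\<And>v. v \<in> set (omit_nth n b) \<Longrightarrow> h v = v"
  shows "map h b = b[n := h (b ! n)]"
proof (rule nth_equalityI)
  fix i
  assume "i < length (map h b)"
  then show "map h b ! i = b[n := h (b ! n)] ! i"
    using assms nth_in_omit_nth[of i b n] by (cases "i = n") auto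
qed simp

lemma sat_psi_M:
  assumes "\<forall>ys \<in> set yss. map fst ys = ss"
  shows "sat M e (psi_M n yss) \<longleftrightarrow> (\<forall>i j. i < j \<and> j < length yss \<longrightarrow>
    e (yss ! i ! n) \<noteq> e (yss ! j ! n) \<and> map e (omit_nth n (yss ! i)) = map e (omit_nth n (yss ! j)))"
proof -
  \<comment> \<open>\<open>tuple_eq\<close> zips its arguments and so expresses equality only for
    tuples of the same length.\<close>
  have "length (omit_nth n (yss ! i)) = length (omit_nth n (yss ! j))"
    if "i < j" "j < length yss" for i j
  proof -
    have "map fst (yss ! i) = map fst (yss ! j)" using assms that by simp
    then have "length (yss ! i) = length (yss ! j)" by (metis length_map)
    then show ?thesis by (simp add: omit_nth_def)
  qed
  then show ?thesis by (auto simp: psi_M_def set_index_pairs sat_tuple_eq)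
qed

lemma wf_psi_M:
  assumes "\<forall>ys \<in> set yss. map fst ys = ss" "n < length ss"
  shows "wf_fm (L :: ('f, 'r, 's) signature) (psi_M n yss)"
  unfolding psi_M_def conj_list_simps
proof
  fix \<theta> :: "('f, 'r, 's) fm"
  assume "\<theta> \<in> set (map (\<lambda>(i, j). And (Neg (Eq (Var (yss ! i ! n)) (Var (yss ! j ! n))))
         (tuple_eq (omit_nth n (yss ! i)) (omit_nth n (yss ! j)))) (index_pairs (length yss)))"
  then obtain i j where ij: "i < j" "j < length yss"
    and \<theta>: "\<theta> = And (Neg (Eq (Var (yss ! i ! n)) (Var (yss ! j ! n))))
         (tuple_eq (omit_nth n (yss ! i)) (omit_nth n (yss ! j)))"
    by (auto simp: set_index_pairs)
  have eq: "map fst (yss ! i) = ss" "map fst (yss ! j) = ss" using assms(1) ij by auto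
  then have "length (yss ! i) = length ss" "length (yss ! j) = length ss" by (metis length_map)+
  then have fst: "fst (yss ! i ! n) = ss ! n" "fst (yss ! j ! n) = ss ! n"
    using eq assms(2) by (metis nth_map)+
  have "map fst (omit_nth n (yss ! i)) = map fst (omit_nth n (yss ! j))"
    using eq by (simp add: map_omit_nth)
  then show "wf_fm L \<theta>"
    unfolding \<theta> using fst has_sort.intros(1)[of L "yss ! i ! n"] has_sort.intros(1)[of L "yss ! j ! n"]
    by (auto simp: wf_tuple_eq)
qed

lemma fv_psi_M:
  assumes "\<forall>ys \<in> set yss. map fst ys = ss" "n < length ss"
  shows "fv (psi_M n yss :: ('f, 'r, 's) fm) \<subseteq> set (concat yss)"
proof -
  have len: "length (yss ! i) = length ss" if "i < length yss" for i
    using assms(1) that by (metis length_map nth_mem)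
  have "fv (tuple_eq (omit_nth n (yss ! i)) (omit_nth n (yss ! j)) :: ('f, 'r, 's) fm) \<subseteq> set (concat yss)"
    if "i < length yss" "j < length yss" for i j
    using fv_tuple_eq[of "omit_nth n (yss ! i)" "omit_nth n (yss ! j)"] that
      set_omit_nth_subset[of n "yss ! i"] set_omit_nth_subset[of n "yss ! j"] nth_mem[of i yss] nth_mem[of j yss]
    by (simp only: set_concat) blast
  moreover have "yss ! i ! n \<in> set (concat yss)" if "i < length yss" for i
    using that len[OF that] assms(2) nth_mem[of i yss] nth_mem[of n "yss ! i"]
    by (simp only: set_concat) blast
  ultimately have *: "fv (And (Neg (Eq (Var (yss ! i ! n)) (Var (yss ! j ! n))))
      (tuple_eq (omit_nth n (yss ! i)) (omit_nth n (yss ! j))) :: ('f, 'r, 's) fm) \<subseteq> set (concat yss)"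
    if "i < j" "j < length yss" for i j
    using that by (simp del: set_concat)
  show ?thesis
    unfolding psi_M_def conj_list_simps
  proof (rule UN_least)
    fix \<theta> :: "('f, 'r, 's) fm"
    assume "\<theta> \<in> set (map (\<lambda>(i, j). And (Neg (Eq (Var (yss ! i ! n)) (Var (yss ! j ! n))))
         (tuple_eq (omit_nth n (yss ! i)) (omit_nth n (yss ! j)))) (index_pairs (length yss)))"
    then obtain i j where "i < j" "j < length yss"
      and "\<theta> = And (Neg (Eq (Var (yss ! i ! n)) (Var (yss ! j ! n))))
         (tuple_eq (omit_nth n (yss ! i)) (omit_nth n (yss ! j)))"
      by (auto simp: set_index_pairs)
    with *[of i j] show "fv \<theta> \<subseteq> set (concat yss)" by (simp only:)
  qed
qed

text \<open>The meaning of \<open>psi_M n\<close> on a list of tuples. It is vacuous for fewer than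
  two tuples, which is the source of the degenerate case of dividing.\<close>

definition varies_at :: "nat \<Rightarrow> 'm list list \<Rightarrow> bool" where
  "varies_at n bs \<longleftrightarrow> (\<forall>i j. i < j \<and> j < length bs \<longrightarrow>
     bs ! i ! n \<noteq> bs ! j ! n \<and> omit_nth n (bs ! i) = omit_nth n (bs ! j))"

section \<open>Pairs in \<open>Xi_M\<close> and algebraicity\<close>

context fo_structure
begin

lemma env_of_tuple_list:
  assumes "\<forall>ys \<in> set yss. map fst ys = ss" "distinct (concat yss)"
    "length bs = length yss" "\<forall>b \<in> set bs. srts M b = ss"
  obtains e where "sorted_env M e" "map (map e) yss = bs"
proof -
  have "map (srts M) bs = map (map fst) yss"
    using assms(1,3,4) by (auto intro!: nth_equalityI)
  then have "srts M (concat bs) = map fst (concat yss)" by (simp add: map_concat)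
  then obtain e where e: "sorted_env M e" "map e (concat yss) = concat bs"
    using env_of_tuple[OF assms(2)] by blast
  have "map (map e) yss = bs"
  proof (rule concat_injective)
    show "concat (map (map e) yss) = concat bs" using e(2) by (simp add: map_concat)
    show "length (map (map e) yss) = length bs" using assms(3) by simp
    have "length (map e (yss ! i)) = length (bs ! i)" if "i < length bs" for i
    proof -
      have "map fst (yss ! i) = srts M (bs ! i)" using assms that by simp
      then show ?thesis by (metis length_map)
    qed
    then show "\<forall>(x, y) \<in> set (zip (map (map e) yss) bs). length x = length y"
      using assms(3) by (auto simp: in_set_zip)
  qed
  with e(1) show thesis by (rule that)
qed

lemma wholds_env: "fv \<psi> \<subseteq> set (concat yss) \<Longrightarrow> wholds M (\<psi>, yss) (map (map e) yss) \<longleftrightarrow> sat M e \<psi>"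
  using holds_env[of \<psi> "concat yss" M e] by (simp add: map_concat)

lemma wholds_varies_at:
  assumes "\<forall>ys \<in> set yss. map fst ys = ss" "distinct (concat yss)" "n < length ss"
    "fv \<psi> \<subseteq> set (concat yss)" "conjuncts \<psi> = conjuncts (psi_M n yss)"
    "length bs = length yss" "\<forall>b \<in> set bs. srts M b = ss"
  shows "wholds M (\<psi>, yss) bs \<longleftrightarrow> varies_at n bs"
proof -
  obtain e where e: "sorted_env M e" "map (map e) yss = bs"
    using env_of_tuple_list[OF assms(1,2,6,7)] .
  have len: "length (yss ! i) = length ss" if "i < length yss" for i
    using assms(1) that by (metis length_map nth_mem)
  have "wholds M (\<psi>, yss) bs \<longleftrightarrow> sat M e (psi_M n yss)"
    using wholds_env[OF assms(4), of e] e(2) sat_conjuncts[of M e \<psi>] sat_conjuncts[of M e "psi_M n yss"]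
      assms(5) by simp
  also have "\<dots> \<longleftrightarrow> varies_at n bs"
    unfolding sat_psi_M[OF assms(1)] varies_at_def assms(6)
  proof (intro all_cong1 imp_cong refl)
    fix i j
    assume ij: "i < j \<and> j < length yss"
    then have "bs ! i = map e (yss ! i)" "bs ! j = map e (yss ! j)" using e(2) by auto
    then show "(e (yss ! i ! n) \<noteq> e (yss ! j ! n) \<and>
        map e (omit_nth n (yss ! i)) = map e (omit_nth n (yss ! j))) \<longleftrightarrow>
      (bs ! i ! n \<noteq> bs ! j ! n \<and> omit_nth n (bs ! i) = omit_nth n (bs ! j))"
      using len[of i] len[of j] ij assms(3) by (simp add: map_omit_nth)
  qed
  finally show ?thesis .
qed

lemma Xi_MI:
  assumes p: "wf_pfm (sig M) (\<phi>, xs, ys)"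
    and yss: "\<forall>ys' \<in> set yss. map fst ys' = map fst ys" "distinct (concat yss)" and n: "n < length ys"
    and \<psi>: "wf_fm (sig M) \<psi>" "fv \<psi> \<subseteq> set (concat yss)" "conjuncts \<psi> = conjuncts (psi_M n yss)"
    and incon: "\<And>a bs. srts M a = map fst xs \<Longrightarrow> length bs = length yss \<Longrightarrow>
      \<forall>b \<in> set bs. srts M b = map fst ys \<Longrightarrow> \<forall>b \<in> set bs. pholds M (\<phi>, xs, ys) a b \<Longrightarrow>
      varies_at n bs \<Longrightarrow> False"
  shows "((\<phi>, xs, ys), (\<psi>, yss)) \<in> Xi_M M"
proof -
  have n': "n < length (map fst ys)" using n by simp
  have "inconsistency_witness M (length yss) (\<phi>, xs, ys) (\<psi>, yss)"
    unfolding inconsistency_witness.simps rsorts.simps lsorts.simps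
  proof (intro conjI notI)
    assume "\<exists>a bs. srts M a = map fst xs \<and> length bs = length yss \<and> (\<forall>b \<in> set bs. srts M b = map fst ys) \<and>
      (\<forall>i < length yss. pholds M (\<phi>, xs, ys) a (bs ! i)) \<and> wholds M (\<psi>, yss) bs"
    then obtain a bs where *: "srts M a = map fst xs" "length bs = length yss"
      "\<forall>b \<in> set bs. srts M b = map fst ys" "\<forall>i < length yss. pholds M (\<phi>, xs, ys) a (bs ! i)"
      "wholds M (\<psi>, yss) bs" by blast
    then have "\<forall>b \<in> set bs. pholds M (\<phi>, xs, ys) a b" by (metis in_set_conv_nth)
    moreover have "varies_at n bs"
      using wholds_varies_at[OF yss n' \<psi>(2,3) *(2,3)] *(5) by blast
    ultimately show False using incon *(1,2,3) by blast
  qed (use yss \<psi>(1,2) in auto)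
  then show ?thesis using p n \<psi>(3) unfolding Xi_M_def Xi_def by blast
qed

lemma Xi_MD:
  assumes "((\<phi>, xs, ys), (\<psi>, yss)) \<in> Xi_M M"
  shows "wf_pfm (sig M) (\<phi>, xs, ys)" "\<forall>ys' \<in> set yss. map fst ys' = map fst ys" "distinct (concat yss)"
    "wf_fm (sig M) \<psi>" "fv \<psi> \<subseteq> set (concat yss)" "\<exists>n < length ys. conjuncts \<psi> = conjuncts (psi_M n yss)"
  using assms by (auto simp: Xi_M_def Xi_def)

lemma Xi_M_wholds:
  assumes "((\<phi>, xs, ys), (\<psi>, yss)) \<in> Xi_M M" "n < length ys" "conjuncts \<psi> = conjuncts (psi_M n yss)"
    "length bs = length yss" "\<forall>b \<in> set bs. srts M b = map fst ys"
  shows "wholds M (\<psi>, yss) bs \<longleftrightarrow> varies_at n bs"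
  using wholds_varies_at[of yss "map fst ys" n \<psi> bs] Xi_MD[OF assms(1)] assms(2-5) by simp

lemma Xi_M_inconsistent:
  assumes "((\<phi>, xs, ys), (\<psi>, yss)) \<in> Xi_M M" "srts M a = map fst xs"
    "length bs = length yss" "\<forall>b \<in> set bs. srts M b = map fst ys"
    "\<forall>b \<in> set bs. pholds M (\<phi>, xs, ys) a b" "wholds M (\<psi>, yss) bs"
  shows False
proof -
  have "inconsistency_witness M (length yss) (\<phi>, xs, ys) (\<psi>, yss)"
    using assms(1) by (auto simp: Xi_M_def Xi_def)
  moreover have "\<forall>i < length yss. pholds M (\<phi>, xs, ys) a (bs ! i)"
    using assms(3,5) by (metis nth_mem)
  ultimately show False
    using assms(2,3,4,6) unfolding inconsistency_witness.simps lsorts.simps rsorts.simps by blast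
qed

text \<open>Otherwise as many distinct solutions as there are blocks, placed at position
  \<open>n\<close> of \<open>b\<close>, would give tuples that differ exactly there and all satisfy
  the formula with \<open>a\<close>, against inconsistency.\<close>

lemma Xi_M_few_solutions:
  assumes Xi: "((\<phi>, xs, ys), (\<psi>, yss)) \<in> Xi_M M" and n: "n < length ys" "conjuncts \<psi> = conjuncts (psi_M n yss)"
    and a: "srts M a = map fst xs" and b: "srts M b = map fst ys"
  defines "S \<equiv> {c. srt M c = srt M (b ! n) \<and> pholds M (\<phi>, xs, ys) a (b[n := c])}"
  shows "finite S \<and> card S < length yss"
proof (rule ccontr)
  assume neg: "\<not> (finite S \<and> card S < length yss)"
  have len: "length b = length ys" using b by (metis length_map)
  obtain cs where cs: "length cs = length yss" "distinct cs" "set cs \<subseteq> S"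
  proof (cases "length yss")
    case (Suc m)
    then show ?thesis using neg at_least_iff_card[of m S] that by (auto simp: less_Suc_eq_le)
  qed (use that in auto)
  define bs where "bs = map (\<lambda>c. b[n := c]) cs"
  have bs: "length bs = length yss" "\<forall>b \<in> set bs. pholds M (\<phi>, xs, ys) a b"
    using cs by (auto simp: bs_def S_def simp del: pholds.simps)
  have srts: "\<forall>b' \<in> set bs. srts M b' = map fst ys"
  proof
    fix b'
    assume "b' \<in> set bs"
    then obtain c where c: "b' = b[n := c]" "srt M c = srt M (b ! n)" using cs(3) by (auto simp: bs_def S_def)
    then have "srts M b' = (srts M b)[n := srts M b ! n]" using n(1) len by (simp add: map_update)
    then show "srts M b' = map fst ys" using b by simp
  qed
  have "varies_at n bs"
    using cs(2) n(1) len by (auto simp: varies_at_def bs_def nth_eq_iff_index_eq)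
  then have "wholds M (\<psi>, yss) bs" using Xi_M_wholds[OF Xi n bs(1) srts] by blast
  then show False using Xi_M_inconsistent[OF Xi a bs(1) srts bs(2)] by blast
qed

text \<open>The formula with parameters \<open>a\<close> and the other entries of \<open>b\<close>
  has fewer solutions than there are blocks. As \<open>b ! n\<close> is one of them, there are at
  least two blocks: a formula that holds somewhere is never in the degenerate case.\<close>

lemma Xi_M_acl:
  assumes Xi: "((\<phi>, xs, ys), (\<psi>, yss)) \<in> Xi_M M" and n: "n < length ys" "conjuncts \<psi> = conjuncts (psi_M n yss)"
    and a: "srts M a = map fst xs" and b: "srts M b = map fst ys" and holds: "pholds M (\<phi>, xs, ys) a b"
  shows "b ! n \<in> acl M (set a \<union> set (omit_nth n b))" "1 < length yss"
proof -
  let ?S = "{c. srt M c = srt M (b ! n) \<and> pholds M (\<phi>, xs, ys) a (b[n := c])}"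
  have fin: "finite ?S" "card ?S < length yss" using Xi_M_few_solutions[OF Xi n a b] by auto
  have "b ! n \<in> ?S" using holds by (simp del: pholds.simps)
  then have "0 < card ?S" using fin(1) card_gt_0_iff by blast
  then show "1 < length yss" using fin(2) by linarith
  have wf: "wf_pfm (sig M) (\<phi>, xs, ys)" using Xi_MD[OF Xi] by blast
  obtain e where e: "sorted_env M e" "map e xs = a" "map e ys = b"
    using env_of_tuples[of xs ys a b] wf a b by auto
  let ?u = "ys ! n"
  have "?u \<in> set ys" "set xs \<inter> set ys = {}" using n(1) wf by auto
  then have u: "?u \<notin> set xs" "e ?u = b ! n" "fst ?u = srt M (b ! n)"
    using n(1) e by auto
  have upd: "sat M (e(?u := c)) \<phi> \<longleftrightarrow> pholds M (\<phi>, xs, ys) a (b[n := c])" for c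
  proof -
    have "map (e(?u := c)) xs = a" using e(2) u(1) by auto
    moreover have "map (e(?u := c)) ys = b[n := c]"
      using wf n(1) e(3) by (auto intro!: nth_equalityI simp: nth_list_update nth_eq_iff_index_eq)
    ultimately show ?thesis using pholds_env[OF wf, of "e(?u := c)"] by metis
  qed
  have "e ?u \<in> acl M (set a \<union> set (omit_nth n b))"
  proof (rule acl_envI)
    show "definable M (set xs \<union> set ys) (\<lambda>e. sat M e \<phi>)"
      by (rule definable_mono[OF definable_sat]) (use wf in auto)
    have "e y \<in> set a \<union> set (omit_nth n b)" if "y \<in> set xs \<union> set ys" "y \<noteq> ?u" for y
    proof (cases "y \<in> set xs")
      case False
      then have "y \<in> set ys" using that by blast
      then obtain i where i: "i < length ys" "y = ys ! i" by (metis in_set_conv_nth)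
      moreover have "i \<noteq> n" using i(2) that(2) by blast
      ultimately show ?thesis using nth_in_omit_nth[of i b n] e(3) by auto
    qed (use e(2) in auto)
    then show "e ` (set xs \<union> set ys - {?u}) \<subseteq> set a \<union> set (omit_nth n b)" by auto
    show "sat M e \<phi>" using pholds_env[OF wf, of e] holds unfolding e(2,3) by blast
    show "finite {c. srt M c = fst ?u \<and> sat M (e(?u := c)) \<phi>}"
      using fin(1) unfolding upd u(3) .
  qed (use e(1) in auto)
  then show "b ! n \<in> acl M (set a \<union> set (omit_nth n b))" using u(2) by simp
qed

text \<open>The formula witnessing that \<open>u\<close> is algebraic is conjoined with the bound on its number of solutions.\<close>

lemma acl_Xi_M_pair:
  assumes "u \<in> acl M (A \<union> D)"
  obtains \<phi> xs ys yss a v where "((\<phi>, xs, ys), (psi_M 0 yss, yss)) \<in> Xi_M M"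
    "set a \<subseteq> A" "set v \<subseteq> D" "srts M a = map fst xs" "srts M (u # v) = map fst ys"
    "pholds M (\<phi>, xs, ys) a (u # v)"
  using assms
proof (rule acl_envE)
  fix \<phi> x zs e
  assume \<phi>: "wf_fm (sig M) \<phi>" "distinct (x # zs)" "fv \<phi> \<subseteq> set (x # zs)"
    "sorted_env M e" "e x = u" "e ` set zs \<subseteq> A \<union> D" "sat M e \<phi>"
    "finite {c. srt M c = fst x \<and> sat M (e(x := c)) \<phi>}"
  define S where "S e = {c. srt M c = fst x \<and> sat M (e(x := c)) \<phi>}" for e
  \<comment> \<open>The number of solutions at the given parameters. Up to \<open>m\<close>
    solutions are allowed, so the pair gets \<open>Suc m\<close> blocks.\<close>
  define m where "m = card (S e)"
  have def_\<phi>: "definable M (set (x # zs)) (\<lambda>e. sat M e \<phi>)"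
    by (rule definable_mono[OF definable_sat]) (use \<phi> in auto)
  have "definable M (set (x # zs)) (\<lambda>e. sat M e \<phi> \<and> finite (S e) \<and> card (S e) \<le> m)"
    unfolding S_def
    by (intro definable_conj[OF def_\<phi>] definable_mono[OF definable_at_most[OF def_\<phi>]]) auto
  then obtain \<chi> where \<chi>: "wf_fm (sig M) \<chi>" "fv \<chi> \<subseteq> set (x # zs)"
    "\<And>e. sorted_env M e \<Longrightarrow> sat M e \<chi> \<longleftrightarrow> sat M e \<phi> \<and> finite (S e) \<and> card (S e) \<le> m"
    unfolding definable_def by blast
  \<comment> \<open>Parameters in \<open>A\<close> join the left block; the others lie in
    \<open>D\<close> and follow \<open>u\<close> in the right block, which puts the distinguished
    variable at position 0.\<close>
  define xs where "xs = filter (\<lambda>z. e z \<in> A) zs"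
  define vs where "vs = filter (\<lambda>z. e z \<notin> A) zs"
  have wf: "wf_pfm (sig M) (\<chi>, xs, x # vs)"
    using \<chi>(1,2) \<phi>(2) by (auto simp: xs_def vs_def)
  obtain yss :: "'s var list list" where yss: "length yss = Suc m" "\<forall>ys \<in> set yss. map fst ys = map fst (x # vs)"
    "distinct (concat yss)"
    using fresh_lists[of "Suc m" "map fst (x # vs)"] by blast
  show thesis
  proof (rule that)
    show "((\<chi>, xs, x # vs), (psi_M 0 yss, yss)) \<in> Xi_M M"
    proof (rule Xi_MI[OF wf yss(2,3) _ wf_psi_M[OF yss(2)] fv_psi_M[OF yss(2)] refl])
      fix a bs
      assume a: "srts M a = map fst xs" and bs: "length bs = length yss"
        "\<forall>b \<in> set bs. srts M b = map fst (x # vs)" "\<forall>b \<in> set bs. pholds M (\<chi>, xs, x # vs) a b"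
        "varies_at 0 bs"
      have pos: "0 < length bs" using bs(1) yss(1) by simp
      have srts: "srts M (bs ! i) = map fst (x # vs)" if "i < length bs" for i
        using bs(2) nth_mem[OF that] by blast
      \<comment> \<open>The tuples share one tail, so a single assignment \<open>E\<close> serves
        for all of them after an update at \<open>x\<close>.\<close>
      have hd: "bs ! i = (bs ! i ! 0) # tl (bs ! 0)" if i: "i < length bs" for i
      proof -
        have "bs ! i \<noteq> []" using srts[OF i] by auto
        moreover have "tl (bs ! i) = tl (bs ! 0)"
          using bs(4) i by (cases "i = 0") (auto simp: varies_at_def omit_nth_def drop_Suc)
        ultimately show ?thesis by (cases "bs ! i") auto
      qed
      obtain E where E: "sorted_env M E" "map E xs = a" "map E (x # vs) = bs ! 0"
        using env_of_tuples[OF _ a srts[OF pos]] wf by auto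
      have tl: "map E vs = tl (bs ! 0)" using arg_cong[OF E(3), of tl] by simp
      have sat: "sat M (E(x := c)) \<chi>" "srt M c = fst x" if c: "c = bs ! i ! 0" and i: "i < length bs" for c i
      proof -
        have x: "x \<notin> set xs" "x \<notin> set vs" using wf by auto
        then have "map (E(x := c)) xs = a" using E(2) by auto
        moreover have "map (E(x := c)) (x # vs) = c # map E vs" using x(2) by simp
        then have "map (E(x := c)) (x # vs) = bs ! i" unfolding tl c by (simp only: hd[OF i, symmetric])
        ultimately show "sat M (E(x := c)) \<chi>"
          using pholds_env[OF wf, of "E(x := c)"] bs(3) nth_mem[OF i] by (simp only:)
        have "srts M (c # tl (bs ! 0)) = map fst (x # vs)"
          using srts[OF i] unfolding c by (simp only: hd[OF i, symmetric])
        then show "srt M c = fst x" by simp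
      qed
      define cs where "cs = map (\<lambda>i. bs ! i ! 0) [0..<length bs]"
      have "cs ! i \<noteq> cs ! j" if "i < j" "j < length cs" for i j
        using bs(4) that by (simp add: varies_at_def cs_def)
      then have "distinct cs"
        unfolding distinct_conv_nth by (metis linorder_neqE_nat)
      moreover have "set cs \<subseteq> S E"
        using sat \<chi>(3)[OF sorted_env_upd[OF E(1)]] by (auto simp: cs_def S_def)
      moreover have "length cs = Suc m" using bs(1) yss(1) by (simp add: cs_def)
      ultimately have "\<not> (finite (S E) \<and> card (S E) \<le> m)" using at_least_iff_card by blast
      \<comment> \<open>\<open>S E\<close> does not depend on the value of \<open>x\<close>, so the
        bound contained in \<open>\<chi>\<close> at the first tuple applies to it.\<close>
      moreover have "finite (S E) \<and> card (S E) \<le> m"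
      proof -
        let ?c = "bs ! 0 ! 0"
        have "sorted_env M (E(x := ?c))" "sat M (E(x := ?c)) \<chi>"
          using sat[OF refl pos] sorted_env_upd[OF E(1)] by auto
        then have "finite (S (E(x := ?c))) \<and> card (S (E(x := ?c))) \<le> m" using \<chi>(3) by blast
        then show ?thesis by (simp add: S_def)
      qed
      ultimately show False by blast
    qed simp_all
    show "set (map e xs) \<subseteq> A" by (auto simp: xs_def)
    show "set (map e vs) \<subseteq> D" using \<phi>(6) by (auto simp: vs_def)
    show "srts M (map e xs) = map fst xs" using \<phi>(4) by simp
    show "srts M (u # map e vs) = map fst (x # vs)" using \<phi>(4,5) by auto
    have "sat M e \<chi>" using \<chi>(3)[OF \<phi>(4)] \<phi>(7,8) by (simp add: m_def S_def)
    then show "pholds M (\<chi>, xs, x # vs) (map e xs) (u # map e vs)"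
      using pholds_env[OF wf, of e] \<phi>(5) by (simp del: pholds.simps)
  qed
qed

end

section \<open>Dividing and the independence relations\<close>

context monster
begin

text \<open>With two or more blocks, a sequence witnessing dividing amounts, up to an automorphism,
  to infinitely many images of \<open>b ! n\<close> over \<open>C\<close> and the remaining entries.
  With at most one block the witness is vacuous, hence the extra disjunct.\<close>

lemma divides_iff:
  assumes C: "small \<kappa> C" and n: "n < length b" and b: "srts M b = rsorts p"
    and w: "\<And>bs. length bs = length (snd w) \<Longrightarrow> \<forall>b \<in> set bs. srts M b = rsorts p \<Longrightarrow>
      wholds M w bs \<longleftrightarrow> varies_at n bs"
  shows "divides M (p, w) b C \<longleftrightarrow> length (snd w) \<le> 1 \<or> b ! n \<notin> acl M (C \<union> set (omit_nth n b))"
proof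
  assume "divides M (p, w) b C"
  then obtain bs where bs: "\<And>i::nat. realises M (bs i) (tp M b C)"
    "\<And>js. length js = length (snd w) \<Longrightarrow> sorted_wrt (<) js \<Longrightarrow> wholds M w (map bs js)"
    unfolding divides_def case_prod_conv by blast
  show "length (snd w) \<le> 1 \<or> b ! n \<notin> acl M (C \<union> set (omit_nth n b))"
  proof (cases "length (snd w) \<le> 1")
    case False
    then obtain k where k: "length (snd w) = Suc (Suc k)"
      by (metis One_nat_def Suc_le_mono le0 not0_implies_Suc)
    have vary: "bs i ! n \<noteq> bs j ! n \<and> omit_nth n (bs i) = omit_nth n (bs j)" if ij: "i < j" for i j
    proof -
      \<comment> \<open>The witness speaks about \<open>k + 2\<close> tuples at once. A pair of
        indices is completed to an increasing list, whose first two places give the condition for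
        the pair.\<close>
      let ?js = "i # j # [Suc j..<Suc j + k]"
      have js: "length ?js = length (snd w)" "sorted_wrt (<) ?js"
        using k ij by (auto simp del: upt_Suc)
      have "srts M (bs i) = rsorts p" for i using realises_tp_srts[OF bs(1)] b by simp
      then have "wholds M w (map bs ?js) \<longleftrightarrow> varies_at n (map bs ?js)"
        using js(1) by (intro w) auto
      moreover have "wholds M w (map bs ?js)" using js by (rule bs(2))
      ultimately have "varies_at n (map bs ?js)" by blast
      moreover have "0 < (1::nat) \<and> 1 < length (map bs ?js)" by simp
      ultimately have "map bs ?js ! 0 ! n \<noteq> map bs ?js ! 1 ! n \<and>
          omit_nth n (map bs ?js ! 0) = omit_nth n (map bs ?js ! 1)"
        unfolding varies_at_def by blast
      then show ?thesis by simp
    qed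
    have "\<exists>h. h \<in> fixes_set M C \<and> map h b = bs i" for i
      using realises_tp_homogeneous[OF C bs(1)] by blast
    then obtain h where h: "\<And>i. h i \<in> fixes_set M C" "\<And>i. map (h i) b = bs i" by metis
    \<comment> \<open>All \<open>h i\<close> send the remaining entries to the same tuple but need
      not fix them; composing with the inverse of \<open>h 0\<close> achieves that.\<close>
    define g where "g i = inv (h 0) \<circ> h i" for i
    have bij: "bij (h 0)" using h(1) by (simp add: fixes_set_def automorphism_def)
    have g: "g i \<in> fixes_set M (C \<union> set (omit_nth n b))" for i
    proof -
      have "omit_nth n (bs i) = omit_nth n (bs 0)" using vary[of 0 i] by (cases "i = 0") auto
      then have "map (h i) (omit_nth n b) = map (h 0) (omit_nth n b)"
        by (simp add: map_omit_nth h(2))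
      then have "g i v = v" if "v \<in> set (omit_nth n b)" for v
        using that bij by (simp add: g_def bij_is_inj)
      moreover have "g i \<in> fixes_set M C"
        unfolding g_def by (intro fixes_set_comp fixes_set_inv struct h(1))
      ultimately show ?thesis by (auto simp: fixes_set_def)
    qed
    have "h i (b ! n) = bs i ! n" for i using h(2)[of i] n by (metis nth_map)
    then have "h i (b ! n) \<noteq> h j (b ! n)" if "i \<noteq> j" for i j
      using vary[of i j] vary[of j i] that by (metis linorder_neqE_nat)
    then have "inj (\<lambda>i. g i (b ! n))"
      using bij by (intro injI) (auto simp: g_def bij_is_surj bij_imp_bij_inv bij_is_inj inj_eq)
    moreover have "range (\<lambda>i. g i (b ! n)) \<subseteq> orbit M (C \<union> set (omit_nth n b)) (b ! n)"
      using g by (auto simp: orbit_def)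
    ultimately have "infinite (orbit M (C \<union> set (omit_nth n b)) (b ! n))"
      using finite_subset finite_imageD infinite_UNIV_nat by metis
    then show ?thesis using finite_orbit by blast
  qed simp
next
  assume *: "length (snd w) \<le> 1 \<or> b ! n \<notin> acl M (C \<union> set (omit_nth n b))"
  show "divides M (p, w) b C"
  proof (cases "length (snd w) \<le> 1")
    case True
    \<comment> \<open>With at most one tuple nothing has to vary, so a constant sequence
      works.\<close>
    then have "wholds M w (map (\<lambda>i. b) js)" if "length js = length (snd w)" for js :: "nat list"
      using that b by (subst w) (auto simp: varies_at_def)
    then show ?thesis
      unfolding divides_def case_prod_conv using b realises_tp_self by (intro conjI exI[of _ "\<lambda>i. b"]) simp_all
  next
    case False
    have "small \<kappa> (C \<union> set (omit_nth n b))" by (intro small_Un C small_finite) simp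
    then have "infinite (orbit M (C \<union> set (omit_nth n b)) (b ! n))"
      using infinite_orbit * False by blast
    then obtain f :: "nat \<Rightarrow> 'm" where f: "inj f" "range f \<subseteq> orbit M (C \<union> set (omit_nth n b)) (b ! n)"
      using infinite_countable_subset by blast
    define bs where "bs i = b[n := f i]" for i
    have bs: "realises M (bs i) (tp M b C)" for i
    proof -
      have "f i \<in> orbit M (C \<union> set (omit_nth n b)) (b ! n)" using f(2) by blast
      then obtain h where h: "h \<in> fixes_set M (C \<union> set (omit_nth n b))" "f i = h (b ! n)"
        unfolding orbit_def by blast
      have "map h b = bs i"
        unfolding bs_def h(2) by (rule map_eq_update[OF n]) (use fixes_setD(2)[OF h(1)] in auto)
      moreover have "h \<in> fixes_set M C" using h(1) by (auto simp: fixes_set_def)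
      ultimately show ?thesis using realises_tp_automorphism[of h C b] by simp
    qed
    have "wholds M w (map bs js)" if js: "length js = length (snd w)" "sorted_wrt (<) js" for js
    proof -
      have "varies_at n (map bs js)"
        unfolding varies_at_def
      proof (intro allI impI)
        fix i j
        assume ij: "i < j \<and> j < length (map bs js)"
        then have "js ! i < js ! j" using js(2) by (simp add: sorted_wrt_iff_nth_less)
        then have "f (js ! i) \<noteq> f (js ! j)" using f(1) by (simp add: inj_eq)
        then show "map bs js ! i ! n \<noteq> map bs js ! j ! n \<and>
            omit_nth n (map bs js ! i) = omit_nth n (map bs js ! j)"
          using ij n by (simp add: bs_def)
      qed
      moreover have "srts M (bs i) = rsorts p" for i using realises_tp_srts[OF bs] b by simp
      ultimately show ?thesis using js(1) by (subst w) auto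
    qed
    then show ?thesis unfolding divides_def case_prod_conv using b bs by blast
  qed
qed

lemma Xi_M_divides_iff:
  assumes Xi: "((\<phi>, xs, ys), (\<psi>, yss)) \<in> Xi_M M" and n: "n < length ys" "conjuncts \<psi> = conjuncts (psi_M n yss)"
    and C: "small \<kappa> C" and b: "srts M b = map fst ys"
  shows "divides M ((\<phi>, xs, ys), (\<psi>, yss)) b C \<longleftrightarrow>
    length yss \<le> 1 \<or> b ! n \<notin> acl M (C \<union> set (omit_nth n b))"
proof -
  have "length b = length ys" using b by (metis length_map)
  then show ?thesis
    using divides_iff[OF C, of n b "(\<phi>, xs, ys)" "(\<psi>, yss)"] Xi_M_wholds[OF Xi n] n(1) b by simp
qed

text \<open>The sets \<open>D\<close> that matter are \<open>C\<close> with a finite tuple added: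
  algebraicity uses finitely many parameters \<open>v\<close>, and a dividing formula contributes
  its entries other than \<open>b ! n\<close>.\<close>

lemma Omega_indep_Xi_M_iff:
  assumes small: "small \<kappa> B" "small \<kappa> C"
  shows "Omega_indep M (Xi_M M) A C B \<longleftrightarrow>
    (\<forall>D. C \<subseteq> D \<and> D \<subseteq> B \<union> C \<longrightarrow> acl M (A \<union> D) \<inter> B \<subseteq> acl M D)"
proof
  assume indep: "Omega_indep M (Xi_M M) A C B"
  show "\<forall>D. C \<subseteq> D \<and> D \<subseteq> B \<union> C \<longrightarrow> acl M (A \<union> D) \<inter> B \<subseteq> acl M D"
  proof (intro allI impI subsetI; elim conjE IntE)
    fix D u
    assume D: "C \<subseteq> D" "D \<subseteq> B \<union> C" and u: "u \<in> acl M (A \<union> D)" "u \<in> B"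
    show "u \<in> acl M D"
    proof (rule ccontr)
      assume notin: "u \<notin> acl M D"
      obtain \<phi> xs ys yss a v where Xi: "((\<phi>, xs, ys), (psi_M 0 yss, yss)) \<in> Xi_M M"
        and av: "set a \<subseteq> A" "set v \<subseteq> D" and srts: "srts M a = map fst xs" "srts M (u # v) = map fst ys"
        and holds: "pholds M (\<phi>, xs, ys) a (u # v)"
        using acl_Xi_M_pair[OF u(1)] .
      have "0 < length ys" using srts(2) by (cases ys) auto
      moreover have "(u # v) ! 0 \<notin> acl M (C \<union> set (omit_nth 0 (u # v)))"
        using notin acl_mono[of "C \<union> set v" D] D(1) av(2) by (auto simp: omit_nth_def)
      ultimately have "divides M ((\<phi>, xs, ys), (psi_M 0 yss, yss)) (u # v) C"
        using Xi_M_divides_iff[OF Xi _ refl small(2) srts(2)] by blast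
      moreover have "((\<phi>, xs, ys), u # v) \<in> tp M a (B \<union> C)"
        using holds Xi_MD(1)[OF Xi] srts u(2) av(2) D(2)
        by (auto simp: tp_def fms_over_def simp del: pholds.simps wf_pfm.simps)
      ultimately have "type_divides M (Xi_M M) (tp M a (B \<union> C)) C"
        using Xi unfolding type_divides_def by blast
      then show False using indep av(1) unfolding Omega_indep_def by blast
    qed
  qed
next
  assume alg: "\<forall>D. C \<subseteq> D \<and> D \<subseteq> B \<union> C \<longrightarrow> acl M (A \<union> D) \<inter> B \<subseteq> acl M D"
  show "Omega_indep M (Xi_M M) A C B"
    unfolding Omega_indep_def
  proof
    assume "\<exists>a. set a \<subseteq> A \<and> type_divides M (Xi_M M) (tp M a (B \<union> C)) C"
    then obtain a \<phi> xs ys \<psi> yss b where a: "set a \<subseteq> A" and Xi: "((\<phi>, xs, ys), (\<psi>, yss)) \<in> Xi_M M"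
      and tp: "((\<phi>, xs, ys), b) \<in> tp M a (B \<union> C)" and div: "divides M ((\<phi>, xs, ys), (\<psi>, yss)) b C"
      unfolding type_divides_def by fastforce
    obtain n where n: "n < length ys" "conjuncts \<psi> = conjuncts (psi_M n yss)" using Xi_MD(6)[OF Xi] by blast
    have b: "srts M a = map fst xs" "srts M b = map fst ys" "set b \<subseteq> B \<union> C"
      and holds: "pholds M (\<phi>, xs, ys) a b"
      using tp by (auto simp: tp_def fms_over_def)
    note acl = Xi_M_acl[OF Xi n b(1,2) holds]
    define D where "D = C \<union> set (omit_nth n b)"
    have notin: "b ! n \<notin> acl M D"
      using div acl(2) unfolding Xi_M_divides_iff[OF Xi n small(2) b(2)] D_def by simp
    have "b ! n \<in> set b" using n(1) b(2) by (metis length_map nth_mem)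
    \<comment> \<open>The entry lies in \<open>B \<union> C\<close>, but not in \<open>C\<close>,
      since \<open>C\<close> is contained in \<open>acl M D\<close>.\<close>
    then have "b ! n \<in> B" using notin acl_superset[of D] b(3) unfolding D_def by blast
    moreover have "b ! n \<in> acl M (A \<union> D)"
      using acl(1) acl_mono[of "set a \<union> set (omit_nth n b)" "A \<union> D"] a by (auto simp: D_def)
    moreover have "D \<subseteq> B \<union> C" using b(3) set_omit_nth_subset[of n b] by (auto simp: D_def)
    ultimately show False using alg notin by (auto simp: D_def)
  qed
qed

text \<open>The criterion is applied at \<open>D\<close> with the other entries of \<open>a\<close>
  added: \<open>a ! n\<close> is not algebraic over this set, and independence keeps it so when
  \<open>C\<close> is added. With at most one block the formula divides over both bases.\<close>

lemma transitive_Xi_M: "transitive_pairs M \<kappa> (Xi_M M)"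
  unfolding transitive_pairs_def
proof safe
  fix \<phi> xs ys \<psi> yss D C a
  assume Xi: "((\<phi>, xs, ys), (\<psi>, yss)) \<in> Xi_M M" and C: "small \<kappa> C" "D \<subseteq> C"
    and indep: "Omega_indep M (Xi_M M) C D (set a)" and div: "divides M ((\<phi>, xs, ys), (\<psi>, yss)) a D"
  obtain n where n: "n < length ys" "conjuncts \<psi> = conjuncts (psi_M n yss)" using Xi_MD(6)[OF Xi] by blast
  have D: "small \<kappa> D" using small_subset[OF C] .
  have a: "srts M a = map fst ys" using div by (simp add: divides_def)
  let ?v = "set (omit_nth n a)"
  have "a ! n \<in> set a" using n(1) a by (metis length_map nth_mem)
  moreover have "acl M (C \<union> (D \<union> ?v)) \<inter> set a \<subseteq> acl M (D \<union> ?v)"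
    using indep Omega_indep_Xi_M_iff[of "set a" D C] D small_finite set_omit_nth_subset[of n a] by blast
  moreover have "C \<union> (D \<union> ?v) = C \<union> ?v" using C(2) by blast
  ultimately show "divides M ((\<phi>, xs, ys), (\<psi>, yss)) a C"
    using div unfolding Xi_M_divides_iff[OF Xi n C(1) a] Xi_M_divides_iff[OF Xi n D a] by auto
qed

lemma M_indep_imp_Omega_indep_Xi_M:
  assumes "small \<kappa> B" "small \<kappa> C" "M_indep M A C B"
  shows "Omega_indep M (Xi_M M) A C B"
  unfolding Omega_indep_Xi_M_iff[OF assms(1,2)]
proof (intro allI impI)
  fix D
  assume D: "C \<subseteq> D \<and> D \<subseteq> B \<union> C"
  then have "acl M (A \<union> D) \<inter> acl M (B \<union> D) = acl M D"
    using assms(3) acl_superset[of "B \<union> C"] unfolding M_indep_def by blast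
  then show "acl M (A \<union> D) \<inter> B \<subseteq> acl M D" using acl_superset[of "B \<union> D"] by blast
qed

text \<open>The two relations agree when the right-hand side is algebraically closed and contains the base.\<close>

lemma star_M_indep_iff:
  assumes small: "small \<kappa> B" "small \<kappa> C"
  shows "star M \<kappa> (M_indep M) A C B \<longleftrightarrow> star M \<kappa> (Omega_indep M (Xi_M M)) A C B"
proof
  assume "star M \<kappa> (M_indep M) A C B"
  then show "star M \<kappa> (Omega_indep M (Xi_M M)) A C B"
    using M_indep_imp_Omega_indep_Xi_M small(2) unfolding star_def by meson
next
  assume star: "star M \<kappa> (Omega_indep M (Xi_M M)) A C B"
  show "star M \<kappa> (M_indep M) A C B"
    unfolding star_def
  proof (intro allI impI; elim conjE)
    fix B'
    assume B': "small \<kappa> B'" "B \<subseteq> B'"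
    \<comment> \<open>The hypothesis is applied to \<open>E\<close> in place of \<open>B'\<close>.
      The sets between \<open>C\<close> and \<open>E\<close> are exactly those over which M-dividing
      from \<open>B'\<close> quantifies.\<close>
    define E where "E = acl M (B' \<union> C)"
    have sBC: "small \<kappa> (B' \<union> C)" by (rule small_Un[OF B'(1) small(2)])
    have E: "small \<kappa> E" unfolding E_def by (rule small_acl[OF sBC])
    have sub: "B' \<union> C \<subseteq> E" unfolding E_def by (rule acl_superset)
    have closed: "acl M E = E" unfolding E_def by (rule acl_idem[OF sBC])
    obtain A' where A': "conjugate M (B \<union> C) A' A" "Omega_indep M (Xi_M M) A' C E"
      using star E sub B'(2) unfolding star_def by blast
    have "M_indep M A' C B'"
      unfolding M_indep_def E_def[symmetric]
    proof (intro allI impI; elim conjE)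
      fix D
      assume D: "C \<subseteq> D" "D \<subseteq> E"
      then have "acl M (A' \<union> D) \<inter> E \<subseteq> acl M D"
        using A'(2) unfolding Omega_indep_Xi_M_iff[OF E small(2)] by blast
      \<comment> \<open>Since \<open>E\<close> is closed, the intersection with \<open>E\<close>
        bounds the one with the closure of \<open>B' \<union> D\<close>.\<close>
      moreover have "acl M (B' \<union> D) \<subseteq> E"
        using acl_mono[of "B' \<union> D" E] sub D(2) closed by blast
      moreover have "acl M D \<subseteq> acl M (A' \<union> D)" "acl M D \<subseteq> acl M (B' \<union> D)"
        by (simp_all add: acl_mono)
      ultimately show "acl M (A' \<union> D) \<inter> acl M (B' \<union> D) = acl M D" by blast
    qed
    with A'(1) show "\<exists>A'. conjugate M (B \<union> C) A' A \<and> M_indep M A' C B'" by blast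
  qed
qed

end

section \<open>Normality\<close>

lemma conjuncts_tuple_eq:
  "conjuncts (tuple_eq xs ys) = (\<lambda>(x, y). Eq (Var x) (Var y)) ` set (zip xs ys)"
  by (auto simp: tuple_eq_def)

text \<open>With a block of length \<open>l\<close> in front, the distinguished variable moves to
  position \<open>l + n\<close>, and what remains after omitting it is the new block followed by the
  old remainder, so the equations split. Order and nesting of the conjunctions differ, hence a
  statement about conjuncts.\<close>

lemma conjuncts_psi_M_append:
  assumes "length zss = length yss" "\<forall>zs \<in> set zss. length zs = l"
  shows "conjuncts (psi_M (l + n) (map2 (@) zss yss) :: ('f, 'r, 's) fm) =
    conjuncts (psi_M n yss) \<union> conjuncts (tuples_equal zss)"
proof -
  have "conjuncts (And (Neg (Eq (Var (map2 (@) zss yss ! i ! (l + n))) (Var (map2 (@) zss yss ! j ! (l + n)))))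
      (tuple_eq (omit_nth (l + n) (map2 (@) zss yss ! i)) (omit_nth (l + n) (map2 (@) zss yss ! j))) :: ('f, 'r, 's) fm) =
    conjuncts (And (Neg (Eq (Var (yss ! i ! n)) (Var (yss ! j ! n))))
      (tuple_eq (omit_nth n (yss ! i)) (omit_nth n (yss ! j)))) \<union>
    conjuncts (tuple_eq (zss ! i) (zss ! j))"
    if "i < j" "j < length yss" for i j
  proof -
    have len: "length (zss ! i) = l" "length (zss ! j) = l" using assms that by auto
    then have "map2 (@) zss yss ! i ! (l + n) = yss ! i ! n" "map2 (@) zss yss ! j ! (l + n) = yss ! j ! n"
      "omit_nth (l + n) (map2 (@) zss yss ! i) = zss ! i @ omit_nth n (yss ! i)"
      "omit_nth (l + n) (map2 (@) zss yss ! j) = zss ! j @ omit_nth n (yss ! j)"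
      using assms that by (simp_all add: nth_append omit_nth_def)
    then show ?thesis using len by (auto simp: conjuncts_tuple_eq)
  qed
  note append = this
  have U: "\<chi> \<in> conjuncts (conj_list (map (\<lambda>(i, j). f i j) (index_pairs k))) \<longleftrightarrow>
      (\<exists>i j. i < j \<and> j < k \<and> \<chi> \<in> conjuncts (f i j))" for \<chi> :: "('f, 'r, 's) fm" and f k
    by (fastforce simp: set_index_pairs)
  have len: "length (map2 (@) zss yss) = length yss" using assms(1) by simp
  show ?thesis
  proof (rule set_eqI)
    fix \<chi> :: "('f, 'r, 's) fm"
    show "\<chi> \<in> conjuncts (psi_M (l + n) (map2 (@) zss yss)) \<longleftrightarrow>
      \<chi> \<in> conjuncts (psi_M n yss) \<union> conjuncts (tuples_equal zss)"
      unfolding psi_M_def tuples_equal_def Un_iff U len assms(1) using append by (metis Un_iff)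
  qed
qed

lemma wf_tuples_equal:
  assumes "\<forall>zs \<in> set zss. map fst zs = ss"
  shows "wf_fm L (tuples_equal zss)"
proof -
  have "wf_fm L (tuple_eq (zss ! i) (zss ! j))" if "i < j" "j < length zss" for i j
    using assms that by (intro wf_tuple_eq) simp
  then show ?thesis by (auto simp: tuples_equal_def set_index_pairs)
qed

lemma fv_tuples_equal: "fv (tuples_equal zss :: ('f, 'r, 's) fm) \<subseteq> set (concat zss)"
proof
  fix x
  assume "x \<in> fv (tuples_equal zss :: ('f, 'r, 's) fm)"
  then obtain i j where "i < j" "j < length zss" "x \<in> fv (tuple_eq (zss ! i) (zss ! j) :: ('f, 'r, 's) fm)"
    by (auto simp: tuples_equal_def set_index_pairs)
  then have "x \<in> set (zss ! i) \<union> set (zss ! j)" "zss ! i \<in> set zss" "zss ! j \<in> set zss"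
    using fv_tuple_eq by fastforce+
  then show "x \<in> set (concat zss)" unfolding set_concat by blast
qed

text \<open>Joining the blocks pairwise only permutes the variables.\<close>

lemma concat_map2_append:
  assumes "length xss = length yss"
  shows "set (concat (map2 (@) xss yss)) = set (concat xss) \<union> set (concat yss)"
    and "distinct (concat xss @ concat yss) \<Longrightarrow> distinct (concat (map2 (@) xss yss))"
proof -
  have set: "set (concat (map2 (@) xss yss)) = set (concat xss) \<union> set (concat yss)"
    if "length xss = length yss" for xss yss :: "'z list list"
    using that by (induction xss yss rule: list_induct2) auto
  show "set (concat (map2 (@) xss yss)) = set (concat xss) \<union> set (concat yss)"
    by (rule set[OF assms])
  show "distinct (concat (map2 (@) xss yss))" if "distinct (concat xss @ concat yss)"
    using assms that
  proof (induction xss yss rule: list_induct2)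
    case (Cons x xs y ys)
    then have "distinct (concat (map2 (@) xs ys))" by auto
    moreover have "set (x @ y) \<inter> set (concat (map2 (@) xs ys)) = {}"
      unfolding set[OF Cons.hyps(1)] using Cons.prems by auto
    ultimately show ?case using Cons.prems by (auto simp del: set_concat)
  qed simp
qed

text \<open>Tuples that vary only at one place of their \<open>ys\<close> part share their
  \<open>zs\<close> part. Moving this common part back to the left contradicts the inconsistency of
  the original pair.\<close>

lemma (in fo_structure) normal_Xi_M: "normal_pairs (Xi_M M)"
  unfolding normal_pairs_def
proof (intro allI impI; elim conjE)
  fix \<phi> and xs zs ys :: "'s var list" and \<psi> yss zss
  assume Xi: "((\<phi>, xs @ zs, ys), (\<psi>, yss)) \<in> Xi_M M" and len: "length zss = length yss"
    and zss: "\<forall>zs' \<in> set zss. map fst zs' = map fst zs" and dist: "distinct (concat zss @ concat yss)"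
  note XiD = Xi_MD[OF Xi]
  let ?wss = "map2 (@) zss yss"
  let ?\<psi> = "And \<psi> (tuples_equal zss)"
  obtain n where n: "n < length ys" "conjuncts \<psi> = conjuncts (psi_M n yss)" using XiD(6) by blast
  have wf: "wf_pfm (sig M) (\<phi>, xs, zs @ ys)" using XiD(1) by auto
  have zl: "\<forall>zs' \<in> set zss. length zs' = length zs" using zss by (metis length_map)
  have wss: "\<forall>ws \<in> set ?wss. map fst ws = map fst (zs @ ys)"
  proof
    fix ws
    assume "ws \<in> set ?wss"
    then obtain z y where zy: "ws = z @ y" "(z, y) \<in> set (zip zss yss)" by auto
    have "map fst z = map fst zs" using zss set_zip_leftD[OF zy(2)] by blast
    moreover have "map fst y = map fst ys" using XiD(2) set_zip_rightD[OF zy(2)] by blast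
    ultimately show "map fst ws = map fst (zs @ ys)" using zy(1) by simp
  qed
  note set = concat_map2_append(1)[OF len]
  have dist': "distinct (concat ?wss)" by (rule concat_map2_append(2)[OF len dist])
  show "((\<phi>, xs, zs @ ys), (?\<psi>, ?wss)) \<in> Xi_M M"
  proof (rule Xi_MI[OF wf wss dist'])
    show "length zs + n < length (zs @ ys)" using n(1) by simp
    show "wf_fm (sig M) ?\<psi>" using XiD(4) wf_tuples_equal[OF zss] by simp
    show "fv ?\<psi> \<subseteq> set (concat ?wss)"
      using XiD(5) fv_tuples_equal[of zss] unfolding set fv.simps by blast
    show "conjuncts ?\<psi> = conjuncts (psi_M (length zs + n) ?wss)"
      unfolding conjuncts.simps n(2) by (rule conjuncts_psi_M_append[OF len zl, symmetric])
    fix a bs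
    assume a: "srts M a = map fst xs" and bs: "length bs = length ?wss"
      "\<forall>b \<in> set bs. srts M b = map fst (zs @ ys)" "\<forall>b \<in> set bs. pholds M (\<phi>, xs, zs @ ys) a b"
      "varies_at (length zs + n) bs"
    let ?l = "length zs"
    have srts_take: "srts M (take ?l b) = map fst zs" and srts_drop: "srts M (drop ?l b) = map fst ys"
      if "b \<in> set bs" for b
      using bs(2) that by (simp_all flip: take_map drop_map)
    have split: "take ?l (omit_nth (?l + n) b) = take ?l b" "drop ?l (omit_nth (?l + n) b) = omit_nth n (drop ?l b)"
      if "b \<in> set bs" for b
    proof -
      have "length b = ?l + length ys" using bs(2) that by (metis length_append length_map)
      then show "take ?l (omit_nth (?l + n) b) = take ?l b"
        "drop ?l (omit_nth (?l + n) b) = omit_nth n (drop ?l b)"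
        using n(1) by (auto simp: omit_nth_def drop_take add.commute)
    qed
    obtain e where e: "sorted_env M e" using ex_sorted_env by blast
    \<comment> \<open>If there is no tuple to take the common part from, any tuple of the right
      sorts does.\<close>
    define d where "d = (if bs = [] then map e zs else take ?l (bs ! 0))"
    have d: "take ?l b = d" if b: "b \<in> set bs" for b
    proof -
      obtain i where i: "i < length bs" "b = bs ! i" using b by (metis in_set_conv_nth)
      have "omit_nth (?l + n) (bs ! 0) = omit_nth (?l + n) b"
        using bs(4) i by (cases "i = 0") (auto simp: varies_at_def)
      moreover have "bs \<noteq> []" "bs ! 0 \<in> set bs" using i(1) by (auto intro!: nth_mem)
      ultimately show ?thesis using split(1)[OF b] split(1)[of "bs ! 0"] by (simp add: d_def)
    qed
    have d_srts: "srts M d = map fst zs"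
      using srts_take[of "bs ! 0"] e by (cases "bs = []") (auto simp: d_def)
    let ?bs = "map (drop ?l) bs"
    show False
    proof (rule Xi_M_inconsistent[OF Xi])
      show "srts M (a @ d) = map fst (xs @ zs)" using a d_srts by simp
      show len': "length ?bs = length yss" using bs(1) len by simp
      show srts': "\<forall>b \<in> set ?bs. srts M b = map fst ys" using srts_drop by simp
      show "\<forall>b \<in> set ?bs. pholds M (\<phi>, xs @ zs, ys) (a @ d) b"
      proof
        fix b'
        assume "b' \<in> set ?bs"
        then obtain b where b: "b \<in> set bs" "b' = drop ?l b" by auto
        then have "d @ b' = b" using d by (metis append_take_drop_id)
        then show "pholds M (\<phi>, xs @ zs, ys) (a @ d) b'" using bs(3) b(1) by auto
      qed
      have "varies_at n ?bs"
        unfolding varies_at_def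
      proof (intro allI impI)
        fix i j
        assume "i < j \<and> j < length ?bs"
        then have ij: "i < j" "j < length bs" "bs ! i \<in> set bs" "bs ! j \<in> set bs" by auto
        then have "bs ! i ! (?l + n) \<noteq> bs ! j ! (?l + n)"
          "omit_nth (?l + n) (bs ! i) = omit_nth (?l + n) (bs ! j)"
          using bs(4) by (auto simp: varies_at_def)
        moreover have "length (bs ! i) = ?l + length ys" "length (bs ! j) = ?l + length ys"
          using bs(2) ij(3,4) by (metis length_append length_map)+
        ultimately show "?bs ! i ! n \<noteq> ?bs ! j ! n \<and> omit_nth n (?bs ! i) = omit_nth n (?bs ! j)"
          using ij split(2)[OF ij(3)] split(2)[OF ij(4)] n(1) by simp
      qed
      then show "wholds M (\<psi>, yss) ?bs" using Xi_M_wholds[OF Xi n len' srts'] by blast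
    qed
  qed
qed

theorem proposition2p36:
  fixes T :: "('f, 'r, 's) fm set"
    and M :: "('f, 'r, 's, 'm) strct"
    and \<kappa> :: "'k rel"
  assumes "complete_theory (sig M) T"
    and "big_model M T \<kappa>"
  shows "(\<forall>A B C. small \<kappa> A \<and> small \<kappa> B \<and> small \<kappa> C \<longrightarrow>
           (Omega_indep M (Xi_M M) A C B \<longleftrightarrow>
             (\<forall>D. C \<subseteq> D \<and> D \<subseteq> B \<union> C \<longrightarrow> acl M (A \<union> D) \<inter> B \<subseteq> acl M D)))
       \<and> (transitive_pairs M \<kappa> (Xi_M M) \<and> normal_pairs (Xi_M M))
       \<and> (\<forall>A B C. small \<kappa> A \<and> small \<kappa> B \<and> small \<kappa> C \<longrightarrow>
           M_indep M A C B \<longrightarrow> Omega_indep M (Xi_M M) A C B)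
       \<and> (\<forall>A B C. small \<kappa> A \<and> small \<kappa> B \<and> small \<kappa> C \<longrightarrow>
           (thorn_indep M \<kappa> A C B \<longleftrightarrow> star M \<kappa> (M_indep M) A C B) \<and>
           (star M \<kappa> (M_indep M) A C B \<longleftrightarrow> star M \<kappa> (Omega_indep M (Xi_M M)) A C B))"
proof -
  interpret monster M \<kappa>
    using assms(2) unfolding big_model_def is_model_def by unfold_locales blast+
  show ?thesis
    unfolding thorn_indep_def
    by (intro conjI allI impI; (elim conjE)?)
      (rule Omega_indep_Xi_M_iff transitive_Xi_M normal_Xi_M M_indep_imp_Omega_indep_Xi_M
        star_M_indep_iff refl; assumption)+
qed

end
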